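(* Let $m,\omega,\hbar$ be positive real numbers, and let $X,P,H$ be linear operators acting in a free $\mathbb{T}$-module $M_0$ and satisfying assumptions (a)–(f) of the context, with $\xi=\xi_1\mathbf{e_1}+\xi_2\mathbf{e_2}$, $\xi_1,\xi_2$ real and $>0$. Put $A=\frac{1}{\sqrt{2m\hbar\omega}}(m\omega X+\mathrm{i}_1P)$ and $A^*=\frac{1}{\sqrt{2m\hbar\omega}}(m\omega X-\mathrm{i}_1P)$. For $k=1,2$ write $A_{\mathbf{k}}=\mathbf{e_k}A$, $A^*_{\mathbf{k}}=\mathbf{e_k}A^*$, $|E\rangle_{\mathbf{k}}=\mathbf{e_k}|E\rangle$, where $|E\rangle$ is the eigenket of $H$, with eigenvalue $E$, given by (e). For $k=1,2$, let $l_k$ be the smallest non-negative integer for which $\frac{P_k(E)}{\hbar\omega}-\left(l_k+\frac12\right)\xi_k\le0$, and put $|\phi_0\rangle_{\mathbf{k}}=A_{\mathbf{k}}^{l_k}|E\rangle_{\mathbf{k}}$. Then $A_{\mathbf{k}}|\phi_0\rangle_{\mathbf{k}}=0$. For $l=0,1,2,\dots$ define $$|\phi_l\rangle_{\mathbf{k}}=(l!\,\xi_k^l)^{-1/2}(A^*_{\mathbf{k}})^l|\phi_0\rangle_{\mathbf{k}},\qquad |\phi_l\rangle=|\phi_l\rangle_{\mathbf{1}}+|\phi_l\rangle_{\mathbf{2}} .$$ No $|\phi_l\rangle_{\mathbf{k}}$ vanishes, $|\phi_l\rangle$ is an eigenket of $H$ with eigenvalue $(l+\frac12)\hbar\omega\xi$,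 and $|\phi_l\rangle$ and $|\phi_{l'}\rangle$ are orthogonal if $l\ne l'$. Let $M:=\{\sum_l w_l|\phi_l\rangle : w_l\in\mathbb{T}\}$ be the collection of all finite linear combinations of the kets $|\phi_l\rangle$ with bicomplex coefficients. Then $M$ is a $\mathbb{T}$-module and $H$ is defined everywhere on $M$. Moreover, for all $l\ge0$, $$|\phi_{l+1}\rangle=\frac{1}{\sqrt{(l+1)\xi}}\,A^*|\phi_l\rangle,\qquad A|\phi_{l+1}\rangle=\sqrt{(l+1)\xi}\;|\phi_l\rangle ,$$ where $\sqrt{(l+1)\xi}=\sqrt{(l+1)\xi_1}\,\mathbf{e_1}+\sqrt{(l+1)\xi_2}\,\mathbf{e_2}$, so that $A$ and $A^*$, and therefore $X$ and $P$, are defined everywhere on $M$. If one sets $(|\phi_0\rangle,|\phi_0\rangle)=1$, then $(|\phi_l\rangle,|\phi_l\rangle)=1$ for all $l=0,1,2,\dots$ Fully specify the scalar product of two arbitrary elements of $M$ by defining, for finite sums (running, without loss of generality, over the same set of indices), $$\Big(\sum_l w_l|\phi_l\rangle,\ \sum_l v_l|\phi_l\rangle\Big):=\sum_l w_l^\dagger v_l\,(|\phi_l\rangle,|\phi_l\rangle)=\sum_l w_l^\dagger v_l .$$ Then the four defining properties of a bicomplex scalar product are satisfied on $M$; the kets $|\phi_l\rangle$ generate $M$ and are linearly independent, so that $M$ is an infinite-dimensional free $\mathbb{T}$-module; and the operators $X,P,H$ acting in $M$, with this scalar product, satisfy all of assumptions (a)–(f).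
   Context: Bicomplex numbers: $\mathbb{T}=\{w_e+w_{1}\mathrm{i}_1+w_{2}\mathrm{i}_2+w_j\mathrm{j} : w_e,w_1,w_2,w_j\in\mathbb{R}\}$ is the commutative ring with $\mathrm{i}_1^2=\mathrm{i}_2^2=-1$, $\mathrm{j}^2=1$, $\mathrm{i}_1\mathrm{i}_2=\mathrm{j}$, $\mathrm{i}_1\mathrm{j}=-\mathrm{i}_2$, $\mathrm{i}_2\mathrm{j}=-\mathrm{i}_1$. Put $\mathbf{e_1}=(1+\mathrm{j})/2$, $\mathbf{e_2}=(1-\mathrm{j})/2$; these are idempotent, $\mathbf{e_1}+\mathbf{e_2}=1$, $\mathbf{e_1}\mathbf{e_2}=0$. Every $w\in\mathbb{T}$ is uniquely $w=z_1\mathbf{e_1}+z_2\mathbf{e_2}$ with $z_1,z_2\in\mathbb{C}(\mathrm{i}_1)=\{x+y\mathrm{i}_1:x,y\in\mathbb{R}\}$, and operations are componentwise; $P_k(w)=z_k$. The conjugate is $w^\dagger=\bar z_1\mathbf{e_1}+\bar z_2\mathbf{e_2}$. $w$ is in the null cone iff $z_1=0$ or $z_2=0$ (i.e. $w$ is not invertible). $\mathbb{D}^+=\{x_1\mathbf{e_1}+x_2\mathbf{e_2}:x_1,x_2\in\mathbb{R},\ x_1,x_2\ge0\}$. Elements of a $\mathbb{T}$-module are called kets. A ket $|\psi\rangle$ is in the null cone iff $\mathbf{e_1}|\psi\rangle=0$ or $\mathbf{e_2}|\psi\rangle=0$. A bicomplex scalar product assigns to two kets a bicomplex number $(|\psi\rangle,|\phi\rangle)$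 so that four properties hold: additivity in the second argument; $(|\psi\rangle,s|\phi\rangle)=s(|\psi\rangle,|\phi\rangle)$ for $s\in\mathbb{T}$; $(|\psi\rangle,|\phi\rangle)=(|\phi\rangle,|\psi\rangle)^\dagger$; and $(|\psi\rangle,|\psi\rangle)=0$ iff $|\psi\rangle=0$. Linear operators are $\mathbb{T}$-linear. An eigenket of an operator $B$ with eigenvalue $\lambda\in\mathbb{T}$ is a nonzero ket $|\psi\rangle$ with $B|\psi\rangle=\lambda|\psi\rangle$. If a ket is normalizable, its scalar product with itself is not in the null cone. Two kets are orthogonal if their scalar product is $0$. Assumptions, for operators acting in a module (called $M_0$ initially, and $M$ in the last conclusion): (a) three linear operators $X,P,H$, related by $H=\frac{1}{2m}P^2+\frac12m\omega^2X^2$, act in the free $\mathbb{T}$-module; (b) $X,P,H$ are self-adjoint with respect to a scalar product (initially not yet fully specified), meaning that $(|\psi\rangle,H|\phi\rangle)=(H|\psi\rangle,|\phi\rangle)$ for any kets $|\psi\rangle,|\phi\rangle$ of the module on which $H$ is defined, and similarly with $X$ and $P$; (c) the scalar product of a ket with itself belongs to $\mathbb{D}^+$; (d) $[X,P]=XP-PX=\mathrm{i}_1\hbar\xi I$, where $\xi\in\mathbb{T}$ is not in the null cone and $I$ is the identity operator; (e) there is at least one normalizable eigenket $|E\rangle$ of $H$ which is not in the null cone and whose eigenvalue $E$ is not in the null cone; (f) eigenkets of $H$ that are not in the null cone and that correspond to eigenvalues whose difference is not in the null cone are orthogonal. The kets formed by applying $A$ and $A^*$ repeatedly to $|E\rangle$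 are understood to be defined. *)

theory Defs
  imports Complex_Main
begin

section \<open>Bicomplex numbers\<close>

datatype bicomplex = Bicomplex (coord_e: real) (coord_1: real) (coord_2: real) (coord_j: real)

lemma bicomplex_eq_iff:
  "w = v \<longleftrightarrow> coord_e w = coord_e v \<and> coord_1 w = coord_1 v \<and> coord_2 w = coord_2 v \<and> coord_j w = coord_j v"
  by (cases w; cases v) auto

instantiation bicomplex :: comm_ring_1
begin

definition "0 = Bicomplex 0 0 0 0"
definition "1 = Bicomplex 1 0 0 0"
definition "w + v = Bicomplex (coord_e w + coord_e v) (coord_1 w + coord_1 v)
                              (coord_2 w + coord_2 v) (coord_j w + coord_j v)"
definition "- w = Bicomplex (- coord_e w) (- coord_1 w) (- coord_2 w) (- coord_j w)"
definition "w - v = Bicomplex (coord_e w - coord_e v) (coord_1 w - coord_1 v)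
                              (coord_2 w - coord_2 v) (coord_j w - coord_j v)"
definition "w * v = Bicomplex
  (coord_e w * coord_e v - coord_1 w * coord_1 v - coord_2 w * coord_2 v + coord_j w * coord_j v)
  (coord_e w * coord_1 v + coord_1 w * coord_e v - coord_2 w * coord_j v - coord_j w * coord_2 v)
  (coord_e w * coord_2 v + coord_2 w * coord_e v - coord_1 w * coord_j v - coord_j w * coord_1 v)
  (coord_e w * coord_j v + coord_j w * coord_e v + coord_1 w * coord_2 v + coord_2 w * coord_1 v)"

lemmas bicomplex_arith_defs =
  zero_bicomplex_def one_bicomplex_def plus_bicomplex_def uminus_bicomplex_def
  minus_bicomplex_def times_bicomplex_def

instance
  by standard (auto simp: bicomplex_arith_defs algebra_simps)

end

instantiation bicomplex :: real_algebra_1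
begin

definition "scaleR (r::real) w = Bicomplex (r * coord_e w) (r * coord_1 w) (r * coord_2 w) (r * coord_j w)"

instance
  by standard (auto simp: scaleR_bicomplex_def bicomplex_arith_defs algebra_simps)

end

definition bc_i1 :: bicomplex where "bc_i1 = Bicomplex 0 1 0 0"
definition bc_i2 :: bicomplex where "bc_i2 = Bicomplex 0 0 1 0"
definition bc_j :: bicomplex where "bc_j = Bicomplex 0 0 0 1"

lemma bicomplex_units:
  "bc_i1 * bc_i1 = -1" "bc_i2 * bc_i2 = -1" "bc_j * bc_j = 1"
  "bc_i1 * bc_i2 = bc_j" "bc_i1 * bc_j = - bc_i2" "bc_i2 * bc_j = - bc_i1"
  by (simp_all add: bc_i1_def bc_i2_def bc_j_def bicomplex_arith_defs)

lemma bicomplex_of_real: "of_real r = Bicomplex r 0 0 0"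
  by (simp add: of_real_def scaleR_bicomplex_def one_bicomplex_def)

lemma bicomplex_coords:
  "w = of_real (coord_e w) + of_real (coord_1 w) * bc_i1 + of_real (coord_2 w) * bc_i2
         + of_real (coord_j w) * bc_j"
  by (cases w) (simp add: bicomplex_of_real bc_i1_def bc_i2_def bc_j_def bicomplex_arith_defs)

definition bc_e1 :: bicomplex where "bc_e1 = (1/2) *\<^sub>R (1 + bc_j)"
definition bc_e2 :: bicomplex where "bc_e2 = (1/2) *\<^sub>R (1 - bc_j)"

lemma bicomplex_idempotents:
  "bc_e1 * bc_e1 = bc_e1" "bc_e2 * bc_e2 = bc_e2" "bc_e1 + bc_e2 = 1" "bc_e1 * bc_e2 = 0"
  by (simp_all add: bc_e1_def bc_e2_def bc_j_def bicomplex_arith_defs scaleR_bicomplex_def)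

text \<open>The subring of elements x + y i1 is identified with the type \<^typ>\<open>complex\<close>.\<close>

definition of_C1 :: "complex \<Rightarrow> bicomplex" where
  "of_C1 z = of_real (Re z) + of_real (Im z) * bc_i1"

definition bc_P1 :: "bicomplex \<Rightarrow> complex" where
  "bc_P1 w = Complex (coord_e w + coord_j w) (coord_1 w - coord_2 w)"
definition bc_P2 :: "bicomplex \<Rightarrow> complex" where
  "bc_P2 w = Complex (coord_e w - coord_j w) (coord_1 w + coord_2 w)"

lemma idempotent_representation:
  "w = of_C1 z1 * bc_e1 + of_C1 z2 * bc_e2 \<longleftrightarrow> z1 = bc_P1 w \<and> z2 = bc_P2 w"
  by (cases w; cases z1; cases z2)
     (auto simp: of_C1_def bc_P1_def bc_P2_def bc_e1_def bc_e2_def bc_j_def bc_i1_def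
        bicomplex_of_real bicomplex_arith_defs scaleR_bicomplex_def field_simps)

definition null_cone :: "bicomplex set" where
  "null_cone = {w. bc_P1 w = 0 \<or> bc_P2 w = 0}"

definition dagger :: "bicomplex \<Rightarrow> bicomplex" where
  "dagger w = of_C1 (cnj (bc_P1 w)) * bc_e1 + of_C1 (cnj (bc_P2 w)) * bc_e2"

definition Dplus :: "bicomplex set" where
  "Dplus = {of_real x1 * bc_e1 + of_real x2 * bc_e2 | x1 x2 :: real. x1 \<ge> 0 \<and> x2 \<ge> 0}"

text \<open>Inversion is componentwise in the idempotent basis; on the null cone the value carries
  no meaning, as for division by zero in a field.\<close>

instantiation bicomplex :: inverse
begin

definition "inverse w = of_C1 (inverse (bc_P1 w)) * bc_e1 + of_C1 (inverse (bc_P2 w)) * bc_e2"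
definition "w div v = w * inverse (v::bicomplex)"

instance ..

end

lemma bc_P_simps:
  "bc_P1 (w * v) = bc_P1 w * bc_P1 v" "bc_P2 (w * v) = bc_P2 w * bc_P2 v"
  "bc_P1 1 = 1" "bc_P2 1 = 1"
  by (simp_all add: bc_P1_def bc_P2_def bicomplex_arith_defs complex_eq_iff algebra_simps)

lemma bicomplex_right_inverse:
  assumes "w \<notin> null_cone"
  shows "w * inverse w = 1"
proof -
  have "bc_P1 (inverse w) = inverse (bc_P1 w)" "bc_P2 (inverse w) = inverse (bc_P2 w)"
    using idempotent_representation inverse_bicomplex_def by metis+
  then have "bc_P1 (w * inverse w) = bc_P1 1" "bc_P2 (w * inverse w) = bc_P2 1"
    using assms by (simp_all add: bc_P_simps null_cone_def)
  then show ?thesis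
    using idempotent_representation by metis
qed

lemma null_cone_iff_not_invertible: "w \<in> null_cone \<longleftrightarrow> \<not> w dvd 1"
proof
  assume "w \<in> null_cone"
  then show "\<not> w dvd 1"
    by (auto simp: null_cone_def dvd_def dest: arg_cong[of _ _ bc_P1] arg_cong[of _ _ bc_P2]
        simp: bc_P_simps)
next
  assume "\<not> w dvd 1"
  then show "w \<in> null_cone"
    using bicomplex_right_inverse by (metis dvd_triv_left)
qed

definition idem :: "nat \<Rightarrow> bicomplex" where
  "idem k = (if k = 1 then bc_e1 else bc_e2)"

definition proj :: "nat \<Rightarrow> bicomplex \<Rightarrow> complex" where
  "proj k w = (if k = 1 then bc_P1 w else bc_P2 w)"


section \<open>Bicomplex modules\<close>

class bicomplex_module = ab_group_add +
  fixes scaleT :: "bicomplex \<Rightarrow> 'a \<Rightarrow> 'a"  (infixr "*\<^sub>T" 75)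
  assumes scaleT_add_right: "s *\<^sub>T (x + y) = s *\<^sub>T x + s *\<^sub>T y"
    and scaleT_add_left: "(s + t) *\<^sub>T x = s *\<^sub>T x + t *\<^sub>T x"
    and scaleT_scaleT: "s *\<^sub>T t *\<^sub>T x = (s * t) *\<^sub>T x"
    and scaleT_one: "1 *\<^sub>T x = x"

interpretation bcm: module "scaleT :: bicomplex \<Rightarrow> 'v \<Rightarrow> 'v::bicomplex_module"
  by standard (rule scaleT_add_right scaleT_add_left scaleT_scaleT scaleT_one)+

definition is_basis :: "'v::bicomplex_module set \<Rightarrow> 'v set \<Rightarrow> bool" where
  "is_basis B M \<longleftrightarrow> bcm.independent B \<and> bcm.span B = M"

definition free_module :: "'v::bicomplex_module set \<Rightarrow> bool" where
  "free_module M \<longleftrightarrow> bcm.subspace M \<and> (\<exists>B. is_basis B M)"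

definition infinite_dim_free_module :: "'v::bicomplex_module set \<Rightarrow> bool" where
  "infinite_dim_free_module M \<longleftrightarrow> free_module M \<and> (\<forall>B. is_basis B M \<longrightarrow> infinite B)"

definition null_ket :: "'v::bicomplex_module \<Rightarrow> bool" where
  "null_ket \<psi> \<longleftrightarrow> bc_e1 *\<^sub>T \<psi> = 0 \<or> bc_e2 *\<^sub>T \<psi> = 0"

definition scalar_product :: "'v::bicomplex_module set \<Rightarrow> ('v \<Rightarrow> 'v \<Rightarrow> bicomplex) \<Rightarrow> bool" where
  "scalar_product M ip \<longleftrightarrow>
     (\<forall>\<psi>\<in>M. \<forall>\<phi>\<in>M. \<forall>\<chi>\<in>M. ip \<psi> (\<phi> + \<chi>) = ip \<psi> \<phi> + ip \<psi> \<chi>) \<and>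
     (\<forall>\<psi>\<in>M. \<forall>\<phi>\<in>M. \<forall>s. ip \<psi> (s *\<^sub>T \<phi>) = s * ip \<psi> \<phi>) \<and>
     (\<forall>\<psi>\<in>M. \<forall>\<phi>\<in>M. ip \<psi> \<phi> = dagger (ip \<phi> \<psi>)) \<and>
     (\<forall>\<psi>\<in>M. ip \<psi> \<psi> = 0 \<longleftrightarrow> \<psi> = 0)"

definition normalizable :: "('v::bicomplex_module \<Rightarrow> 'v \<Rightarrow> bicomplex) \<Rightarrow> 'v \<Rightarrow> bool" where
  "normalizable ip \<psi> \<longleftrightarrow> (\<exists>s. ip (s *\<^sub>T \<psi>) (s *\<^sub>T \<psi>) = 1)"


section \<open>Operators\<close>

text \<open>Operators need not be defined on the whole module: an operator is a partial function
  whose domain is a submodule.  Sums are defined where both summands are, compositions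
  (\<^term>\<open>B \<circ>\<^sub>m C\<close>) where the inner value exists and lies in the domain of the outer operator.\<close>

definition linear_operator :: "'v::bicomplex_module set \<Rightarrow> ('v \<rightharpoonup> 'v) \<Rightarrow> bool" where
  "linear_operator M B \<longleftrightarrow>
     bcm.subspace (dom B) \<and> dom B \<subseteq> M \<and> ran B \<subseteq> M \<and>
     (\<forall>\<psi>\<in>dom B. \<forall>\<phi>\<in>dom B. B (\<psi> + \<phi>) = Some (the (B \<psi>) + the (B \<phi>))) \<and>
     (\<forall>s. \<forall>\<psi>\<in>dom B. B (s *\<^sub>T \<psi>) = Some (s *\<^sub>T the (B \<psi>)))"

definition op_add :: "('v::bicomplex_module \<rightharpoonup> 'v) \<Rightarrow> ('v \<rightharpoonup> 'v) \<Rightarrow> ('v \<rightharpoonup> 'v)" where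
  "op_add B C = (\<lambda>\<psi>. case (B \<psi>, C \<psi>) of (Some x, Some y) \<Rightarrow> Some (x + y) | _ \<Rightarrow> None)"

definition op_scale :: "bicomplex \<Rightarrow> ('v::bicomplex_module \<rightharpoonup> 'v) \<Rightarrow> ('v \<rightharpoonup> 'v)" where
  "op_scale s B = (\<lambda>\<psi>. map_option (scaleT s) (B \<psi>))"

definition op_power :: "('v \<rightharpoonup> 'v) \<Rightarrow> nat \<Rightarrow> ('v \<rightharpoonup> 'v)" where
  "op_power B n = (((\<circ>\<^sub>m) B) ^^ n) Some"

definition self_adjoint :: "('v \<Rightarrow> 'v \<Rightarrow> bicomplex) \<Rightarrow> ('v \<rightharpoonup> 'v) \<Rightarrow> bool" where
  "self_adjoint ip B \<longleftrightarrow> (\<forall>\<psi>\<in>dom B. \<forall>\<phi>\<in>dom B. ip \<psi> (the (B \<phi>)) = ip (the (B \<psi>)) \<phi>)"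

definition eigenket :: "('v::bicomplex_module \<rightharpoonup> 'v) \<Rightarrow> 'v \<Rightarrow> bicomplex \<Rightarrow> bool" where
  "eigenket B \<psi> ev \<longleftrightarrow> \<psi> \<noteq> 0 \<and> B \<psi> = Some (ev *\<^sub>T \<psi>)"

definition oscillator_hamiltonian ::
    "real \<Rightarrow> real \<Rightarrow> ('v::bicomplex_module \<rightharpoonup> 'v) \<Rightarrow> ('v \<rightharpoonup> 'v) \<Rightarrow> ('v \<rightharpoonup> 'v)" where
  "oscillator_hamiltonian m \<omega> X P =
     op_add (op_scale (of_real (1 / (2 * m))) (op_power P 2))
            (op_scale (of_real (1 / 2 * m * \<omega>^2)) (op_power X 2))"

definition lowering_op ::
    "real \<Rightarrow> real \<Rightarrow> real \<Rightarrow> ('v::bicomplex_module \<rightharpoonup> 'v) \<Rightarrow> ('v \<rightharpoonup> 'v) \<Rightarrow> ('v \<rightharpoonup> 'v)" where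
  "lowering_op m \<omega> hbar X P =
     op_scale (of_real (1 / sqrt (2 * m * hbar * \<omega>)))
       (op_add (op_scale (of_real (m * \<omega>)) X) (op_scale bc_i1 P))"

definition raising_op ::
    "real \<Rightarrow> real \<Rightarrow> real \<Rightarrow> ('v::bicomplex_module \<rightharpoonup> 'v) \<Rightarrow> ('v \<rightharpoonup> 'v) \<Rightarrow> ('v \<rightharpoonup> 'v)" where
  "raising_op m \<omega> hbar X P =
     op_scale (of_real (1 / sqrt (2 * m * hbar * \<omega>)))
       (op_add (op_scale (of_real (m * \<omega>)) X) (op_scale (- bc_i1) P))"

definition commutation_relation ::
    "real \<Rightarrow> bicomplex \<Rightarrow> ('v::bicomplex_module \<rightharpoonup> 'v) \<Rightarrow> ('v \<rightharpoonup> 'v) \<Rightarrow> bool" where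
  "commutation_relation hbar \<xi> X P \<longleftrightarrow>
     (\<forall>\<psi> \<in> dom (X \<circ>\<^sub>m P) \<inter> dom (P \<circ>\<^sub>m X).
        the ((X \<circ>\<^sub>m P) \<psi>) - the ((P \<circ>\<^sub>m X) \<psi>) = (bc_i1 * of_real hbar * \<xi>) *\<^sub>T \<psi>)"

text \<open>Every word in the two operators can be applied to the given ket.\<close>

definition words_defined_at :: "('v \<rightharpoonup> 'v) \<Rightarrow> ('v \<rightharpoonup> 'v) \<Rightarrow> 'v \<Rightarrow> bool" where
  "words_defined_at A A' \<psi> \<longleftrightarrow>
     (\<forall>Bs. set Bs \<subseteq> {A, A'} \<longrightarrow> \<psi> \<in> dom (foldr (\<circ>\<^sub>m) Bs Some))"


section \<open>The standing assumptions on the harmonic oscillator\<close>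

text \<open>The conjuncts are, in order: the operators act in a free module and are related by the
  Hamiltonian; they are self-adjoint for a scalar product; squares lie in \<^term>\<open>Dplus\<close>;
  the canonical commutation relation; existence of the eigenket \<open>E\<close> (eigenvalue \<open>ev\<close>), to which
  the ladder operators can be applied repeatedly; orthogonality of eigenkets.\<close>

definition bicomplex_oscillator ::
    "'v::bicomplex_module set \<Rightarrow> ('v \<Rightarrow> 'v \<Rightarrow> bicomplex) \<Rightarrow> real \<Rightarrow> real \<Rightarrow> real \<Rightarrow> bicomplex \<Rightarrow>
     ('v \<rightharpoonup> 'v) \<Rightarrow> ('v \<rightharpoonup> 'v) \<Rightarrow> ('v \<rightharpoonup> 'v) \<Rightarrow> 'v \<Rightarrow> bicomplex \<Rightarrow> bool" where
  "bicomplex_oscillator M ip m \<omega> hbar \<xi> X P H E ev \<longleftrightarrow>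
     (free_module M \<and> linear_operator M X \<and> linear_operator M P \<and> linear_operator M H \<and>
        H = oscillator_hamiltonian m \<omega> X P) \<and>
     (scalar_product M ip \<and> self_adjoint ip X \<and> self_adjoint ip P \<and> self_adjoint ip H) \<and>
     (\<forall>\<psi>\<in>M. ip \<psi> \<psi> \<in> Dplus) \<and>
     (\<xi> \<notin> null_cone \<and> commutation_relation hbar \<xi> X P) \<and>
     (eigenket H E ev \<and> normalizable ip E \<and> \<not> null_ket E \<and> ev \<notin> null_cone \<and>
        words_defined_at (lowering_op m \<omega> hbar X P) (raising_op m \<omega> hbar X P) E) \<and>
     (\<forall>\<psi> \<phi> s t. eigenket H \<psi> s \<and> eigenket H \<phi> t \<and> \<not> null_ket \<psi> \<and> \<not> null_ket \<phi> \<and>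
        s - t \<notin> null_cone \<longrightarrow> ip \<psi> \<phi> = 0)"

end

theory Submission
  imports Defs
begin

text \<open>
  Let \<open>D\<close> be the set of kets to which every word in the ladder operators \<open>A\<close>, \<open>A\<^sup>*\<close> applies. It is a
  submodule invariant under \<open>A\<close>, \<open>A\<^sup>*\<close>, hence under \<open>X\<close>, \<open>P\<close>, \<open>H\<close>, and on it
  \<open>A\<^sup>* A = H/(\<hbar>\<omega>) - \<xi>/2\<close> and \<open>A A\<^sup>* = A\<^sup>* A + \<xi>\<close>. Since
  \<open>(A\<psi>, A\<psi>) = (\<psi>, A\<^sup>* A \<psi>)\<close> lies in \<^term>\<open>Dplus\<close>, in each idempotent component lowering \<open>E\<close> must end
  in a nonzero ket annihilated by \<open>A\<close>.

  All \<open>(\<phi> l, \<phi> l)\<close> equal the same invertible \<open>\<kappa>\<close>, so on the span of the \<open>\<phi> l\<close> the newly specified scalar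
  product is \<open>\<kappa>\<^sup>-\<^sup>1\<close> times the original one and inherits its properties.
\<close>

text \<open>Two obstacles shape the argument. The scalars have zero divisors, so the square of a
  nonzero ket may vanish in one component; positivity is therefore used only on kets fixed by one
  \<open>idem k\<close>, where that component of the square is strictly positive. And the two
  components of \<open>E\<close> may need different numbers of lowering steps, so the ground ket is
  glued from two pieces and is not in general a power of the lowering operator applied to
  \<open>E\<close>. Its energy comes from being annihilated by that operator, not from
  \<open>Ev\<close>.

  The operators are partial, but on \<open>D\<close> they act as total functions. The ladder algebra
  is developed for abstract total maps \<open>a\<close> and \<open>ad\<close>; position and momentum
  return through a locale over an invariant submodule, instantiated with \<open>D\<close> and again
  with the span \<open>M\<close>. The conclusion concerns every function obeying the defining
  formula, so uniqueness on the span is needed along with existence.\<close>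

lemma bicomplex_eqI: "bc_P1 w = bc_P1 v \<Longrightarrow> bc_P2 w = bc_P2 v \<Longrightarrow> w = v"
  by (metis idempotent_representation)

lemma bc_P1_arith [simp]:
  "bc_P1 0 = 0" "bc_P1 1 = 1" "bc_P1 (w + v) = bc_P1 w + bc_P1 v" "bc_P1 (- w) = - bc_P1 w"
  "bc_P1 (w - v) = bc_P1 w - bc_P1 v" "bc_P1 (w * v) = bc_P1 w * bc_P1 v"
  "bc_P1 (of_real r) = of_real r" "bc_P1 bc_e1 = 1" "bc_P1 bc_e2 = 0" "bc_P1 bc_i1 = \<i>"
  by (auto simp: bc_P1_def bicomplex_arith_defs complex_eq_iff bicomplex_of_real bc_e1_def bc_e2_def
      bc_j_def bc_i1_def scaleR_bicomplex_def algebra_simps)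

lemma bc_P2_arith [simp]:
  "bc_P2 0 = 0" "bc_P2 1 = 1" "bc_P2 (w + v) = bc_P2 w + bc_P2 v" "bc_P2 (- w) = - bc_P2 w"
  "bc_P2 (w - v) = bc_P2 w - bc_P2 v" "bc_P2 (w * v) = bc_P2 w * bc_P2 v"
  "bc_P2 (of_real r) = of_real r" "bc_P2 bc_e1 = 0" "bc_P2 bc_e2 = 1" "bc_P2 bc_i1 = \<i>"
  by (auto simp: bc_P2_def bicomplex_arith_defs complex_eq_iff bicomplex_of_real bc_e1_def bc_e2_def
      bc_j_def bc_i1_def scaleR_bicomplex_def algebra_simps)

lemma bc_P_dagger [simp]: "bc_P1 (dagger w) = cnj (bc_P1 w)" "bc_P2 (dagger w) = cnj (bc_P2 w)"
  using idempotent_representation dagger_def by metis+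

lemma bc_P_inverse [simp]:
  "bc_P1 (inverse w) = inverse (bc_P1 w)" "bc_P2 (inverse w) = inverse (bc_P2 w)"
  using idempotent_representation inverse_bicomplex_def by metis+

lemma bc_P_of_nat [simp]: "bc_P1 (of_nat n) = of_nat n" "bc_P2 (of_nat n) = of_nat n"
  by (induction n) simp_all

lemma bc_P_numeral [simp]: "bc_P1 (numeral n) = numeral n" "bc_P2 (numeral n) = numeral n"
  using bc_P_of_nat[of "numeral n"] by simp_all

text \<open>\<open>proj\<close> and \<open>idem\<close> treat every index other than 1 as 2, so
  these rules need no range for \<open>k\<close>. The range becomes essential once the real
  component \<open>xi k\<close> enters.\<close>

lemma proj_arith [simp]:
  "proj k 0 = 0" "proj k 1 = 1" "proj k (w + v) = proj k w + proj k v" "proj k (- w) = - proj k w"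
  "proj k (w - v) = proj k w - proj k v" "proj k (w * v) = proj k w * proj k v"
  "proj k (of_real r) = of_real r" "proj k (of_nat n) = of_nat n" "proj k bc_i1 = \<i>" "proj k (idem k) = 1"
  "proj k (dagger w) = cnj (proj k w)" "proj k (inverse w) = inverse (proj k w)"
  by (auto simp: proj_def idem_def)

lemma idem_mult_eq_0_iff: "idem k * w = 0 \<longleftrightarrow> proj k w = 0"
  by (auto simp: idem_def proj_def intro!: bicomplex_eqI dest: arg_cong[of _ _ bc_P1] arg_cong[of _ _ bc_P2])

lemma idem_simps [simp]:
  "idem k * idem k = idem k" "idem (Suc 0) = bc_e1" "idem 2 = bc_e2" "dagger (idem k) = idem k"
  by (auto simp: idem_def intro!: bicomplex_eqI)

lemma proj_simps: "proj (Suc 0) w = bc_P1 w" "proj 1 w = bc_P1 w" "proj 2 w = bc_P2 w"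
  by (auto simp: proj_def)

lemma dagger_simps [simp]:
  "dagger 0 = 0" "dagger 1 = 1" "dagger (w + v) = dagger w + dagger v" "dagger (w - v) = dagger w - dagger v"
  "dagger (- w) = - dagger w"
  "dagger (w * v) = dagger w * dagger v" "dagger (dagger w) = w" "dagger (of_real r) = of_real r"
  "dagger bc_i1 = - bc_i1" "dagger bc_e1 = bc_e1" "dagger bc_e2 = bc_e2"
  by (rule bicomplex_eqI; simp)+

lemma bicomplex_divide: "1 / w = inverse (w :: bicomplex)"
  by (simp add: divide_bicomplex_def)

text \<open>Replaces cancellation in a field: a scalar outside the null cone is a unit, and
  multiplying by its inverse removes it.\<close>

lemma null_cone_mult_cancel:
  assumes "w \<notin> null_cone" "w * v = 0" shows "v = 0"
  using assms by (metis bicomplex_right_inverse mult.commute mult.left_commute mult_1 mult_zero_right)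

lemma Dplus_iff:
  "w \<in> Dplus \<longleftrightarrow> bc_P1 w \<in> \<real> \<and> bc_P2 w \<in> \<real> \<and> Re (bc_P1 w) \<ge> 0 \<and> Re (bc_P2 w) \<ge> 0"
proof
  assume "bc_P1 w \<in> \<real> \<and> bc_P2 w \<in> \<real> \<and> Re (bc_P1 w) \<ge> 0 \<and> Re (bc_P2 w) \<ge> 0"
  moreover from this
  have "w = of_real (Re (bc_P1 w)) * bc_e1 + of_real (Re (bc_P2 w)) * bc_e2"
    by (intro bicomplex_eqI) (auto simp: complex_is_Real_iff complex_eq_iff)
  ultimately show "w \<in> Dplus"
    unfolding Dplus_def by blast
qed (auto simp: Dplus_def)

lemma Dplus_proj: "w \<in> Dplus \<Longrightarrow> proj k w \<in> \<real> \<and> Re (proj k w) \<ge> 0"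
  by (auto simp: Dplus_iff proj_def)

lemma Dplus_mult: "w \<in> Dplus \<Longrightarrow> v \<in> Dplus \<Longrightarrow> w * v \<in> Dplus"
  by (auto simp: Dplus_iff complex_is_Real_iff)

lemma Dplus_inverse: "w \<in> Dplus \<Longrightarrow> inverse w \<in> Dplus"
  by (auto simp: Dplus_iff complex_is_Real_iff)

text \<open>Its purpose is \<open>inverse \<kappa>\<close>: rescaling by a scalar fixed by
  \<open>dagger\<close> keeps a scalar product Hermitian.\<close>

lemma dagger_Dplus: "w \<in> Dplus \<Longrightarrow> dagger w = w"
  by (auto simp: Dplus_iff intro!: bicomplex_eqI simp: Reals_cnj_iff)

section \<open>Ladder operators on a bicomplex module\<close>

text \<open>Total maps on an invariant submodule hide the domains of the partial operators;
  linearity, adjointness, the commutator and positivity carry the ladder argument.\<close>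

locale bicomplex_ladder =
  fixes D :: "'v::bicomplex_module set" and ip :: "'v \<Rightarrow> 'v \<Rightarrow> bicomplex"
    and a ad :: "'v \<Rightarrow> 'v" and \<xi> :: bicomplex and xi :: "nat \<Rightarrow> real"
  assumes subspace: "bcm.subspace D"
    and scalar_product: "scalar_product D ip"
    and ip_Dplus: "\<psi> \<in> D \<Longrightarrow> ip \<psi> \<psi> \<in> Dplus"
    and a_closed [simp]: "\<psi> \<in> D \<Longrightarrow> a \<psi> \<in> D"
    and ad_closed [simp]: "\<psi> \<in> D \<Longrightarrow> ad \<psi> \<in> D"
    and a_add: "\<psi> \<in> D \<Longrightarrow> \<phi> \<in> D \<Longrightarrow> a (\<psi> + \<phi>) = a \<psi> + a \<phi>"
    and ad_add: "\<psi> \<in> D \<Longrightarrow> \<phi> \<in> D \<Longrightarrow> ad (\<psi> + \<phi>) = ad \<psi> + ad \<phi>"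
    and a_scale: "\<psi> \<in> D \<Longrightarrow> a (s *\<^sub>T \<psi>) = s *\<^sub>T a \<psi>"
    and ad_scale: "\<psi> \<in> D \<Longrightarrow> ad (s *\<^sub>T \<psi>) = s *\<^sub>T ad \<psi>"
    and adjoint: "\<psi> \<in> D \<Longrightarrow> \<phi> \<in> D \<Longrightarrow> ip \<psi> (a \<phi>) = ip (ad \<psi>) \<phi>"
    and commutator: "\<psi> \<in> D \<Longrightarrow> a (ad \<psi>) = ad (a \<psi>) + \<xi> *\<^sub>T \<psi>"
    and xi_pos: "xi 1 > 0" "xi 2 > 0"
    and xi_eq: "\<xi> = of_real (xi 1) * bc_e1 + of_real (xi 2) * bc_e2"
begin

lemma D_closed [simp]:
  "0 \<in> D" "\<psi> \<in> D \<Longrightarrow> \<phi> \<in> D \<Longrightarrow> \<psi> + \<phi> \<in> D" "\<psi> \<in> D \<Longrightarrow> s *\<^sub>T \<psi> \<in> D"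
  using subspace by (auto intro: bcm.subspace_0 bcm.subspace_add bcm.subspace_scale)

lemma ip_right:
  "\<psi> \<in> D \<Longrightarrow> \<phi> \<in> D \<Longrightarrow> \<chi> \<in> D \<Longrightarrow> ip \<psi> (\<phi> + \<chi>) = ip \<psi> \<phi> + ip \<psi> \<chi>"
  "\<psi> \<in> D \<Longrightarrow> \<phi> \<in> D \<Longrightarrow> ip \<psi> (s *\<^sub>T \<phi>) = s * ip \<psi> \<phi>"
  using scalar_product unfolding scalar_product_def by blast+

lemma ip_dagger: "\<psi> \<in> D \<Longrightarrow> \<phi> \<in> D \<Longrightarrow> ip \<psi> \<phi> = dagger (ip \<phi> \<psi>)"
  using scalar_product unfolding scalar_product_def by blast

lemma ip_eq_0_iff: "\<psi> \<in> D \<Longrightarrow> ip \<psi> \<psi> = 0 \<longleftrightarrow> \<psi> = 0"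
  using scalar_product unfolding scalar_product_def by blast

lemma ip_left:
  "\<psi> \<in> D \<Longrightarrow> \<phi> \<in> D \<Longrightarrow> \<chi> \<in> D \<Longrightarrow> ip (\<phi> + \<chi>) \<psi> = ip \<phi> \<psi> + ip \<chi> \<psi>"
  "\<psi> \<in> D \<Longrightarrow> \<phi> \<in> D \<Longrightarrow> ip (s *\<^sub>T \<phi>) \<psi> = dagger s * ip \<phi> \<psi>"
  by (simp_all add: ip_dagger[of _ \<psi>] ip_right)

lemma ip_zero [simp]: "\<psi> \<in> D \<Longrightarrow> ip \<psi> 0 = 0" "\<psi> \<in> D \<Longrightarrow> ip 0 \<psi> = 0"
  using ip_right(2)[of \<psi> 0 0] ip_left(2)[of \<psi> 0 0] by auto

lemma ip_sum_right:
  "finite L \<Longrightarrow> \<psi> \<in> D \<Longrightarrow> (\<And>l. l \<in> L \<Longrightarrow> f l \<in> D) \<Longrightarrow> ip \<psi> (\<Sum>l\<in>L. f l) = (\<Sum>l\<in>L. ip \<psi> (f l))"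
  by (induction L rule: finite_induct) (auto simp: ip_right bcm.subspace_sum[OF subspace])

lemma ip_sum_left:
  "finite L \<Longrightarrow> \<psi> \<in> D \<Longrightarrow> (\<And>l. l \<in> L \<Longrightarrow> f l \<in> D) \<Longrightarrow> ip (\<Sum>l\<in>L. f l) \<psi> = (\<Sum>l\<in>L. ip (f l) \<psi>)"
  by (induction L rule: finite_induct) (auto simp: ip_left bcm.subspace_sum[OF subspace])

lemma adjoint': "\<psi> \<in> D \<Longrightarrow> \<phi> \<in> D \<Longrightarrow> ip \<psi> (ad \<phi>) = ip (a \<psi>) \<phi>"
  using adjoint[of \<phi> \<psi>] ip_dagger[of \<psi> "ad \<phi>"] ip_dagger[of "a \<psi>" \<phi>] by simp

lemma proj_xi: "k \<in> {1, 2} \<Longrightarrow> proj k \<xi> = of_real (xi k)"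
  by (auto simp: xi_eq proj_def)

lemma xi_gt_0: "k \<in> {1, 2} \<Longrightarrow> xi k > 0"
  using xi_pos by auto

text \<open>Linearity gives \<open>ip \<psi> \<psi> = idem k * ip \<psi> \<psi>\<close>, so the
  square is concentrated in component \<open>k\<close>; being nonzero and in \<open>Dplus\<close>,
  it is positive there. For a ket not fixed by \<open>idem k\<close> this component could
  vanish.\<close>

lemma ip_norm_pos:
  assumes "\<psi> \<in> D" "idem k *\<^sub>T \<psi> = \<psi>" "\<psi> \<noteq> 0"
  shows "proj k (ip \<psi> \<psi>) \<in> \<real>" "Re (proj k (ip \<psi> \<psi>)) > 0" "proj k (ip \<psi> \<psi>) \<noteq> 0"
proof -
  have "ip \<psi> \<psi> = idem k * ip \<psi> \<psi>"
    using ip_right(2)[OF assms(1,1), of "idem k"] assms(2) by simp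
  then have *: "proj k (ip \<psi> \<psi>) \<noteq> 0"
    using assms idem_mult_eq_0_iff[of k "ip \<psi> \<psi>"] ip_eq_0_iff by auto
  moreover show "proj k (ip \<psi> \<psi>) \<in> \<real>"
    using Dplus_proj ip_Dplus assms by blast
  moreover have "Re (proj k (ip \<psi> \<psi>)) \<ge> 0"
    using Dplus_proj ip_Dplus assms by blast
  ultimately show "Re (proj k (ip \<psi> \<psi>)) > 0"
    by (auto simp: complex_is_Real_iff complex_eq_iff)
  show "proj k (ip \<psi> \<psi>) \<noteq> 0" by fact
qed

text \<open>Moving one ladder operator across the product leaves \<open>ad (a \<psi>)\<close>, a
  known multiple of \<open>\<psi>\<close>. In \<open>ip_raised\<close> the commutator first
  exchanges the factors, which adds \<open>\<xi>\<close>.\<close>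

lemma ip_lowered:
  assumes "\<psi> \<in> D" "ad (a \<psi>) = \<nu> *\<^sub>T \<psi>"
  shows "ip (a \<psi>) (a \<psi>) = \<nu> * ip \<psi> \<psi>"
  using assms adjoint'[of \<psi> "a \<psi>"] by (simp add: ip_right)

lemma ip_raised:
  assumes "\<psi> \<in> D" "ad (a \<psi>) = \<nu> *\<^sub>T \<psi>"
  shows "ip (ad \<psi>) (ad \<psi>) = (\<nu> + \<xi>) * ip \<psi> \<psi>"
  using assms adjoint[of \<psi> "ad \<psi>"] by (simp add: ip_right commutator algebra_simps)

lemma lowered_eigen:
  assumes "\<psi> \<in> D" "ad (a \<psi>) = \<nu> *\<^sub>T \<psi>"
  shows "ad (a (a \<psi>)) = (\<nu> - \<xi>) *\<^sub>T a \<psi>"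
  using commutator[of "a \<psi>"] assms by (simp add: a_scale bcm.scale_left_diff_distrib)

lemma raised_eigen:
  assumes "\<psi> \<in> D" "ad (a \<psi>) = \<nu> *\<^sub>T \<psi>"
  shows "ad (a (ad \<psi>)) = (\<nu> + \<xi>) *\<^sub>T ad \<psi>"
  using assms by (simp add: commutator ad_scale ad_add scaleT_add_left)

text \<open>The identity \<open>ip_lowered\<close>, read in component \<open>k\<close>, makes
  \<open>proj k \<nu>\<close> the quotient of a nonnegative real by a positive one, and the
  numerator vanishes exactly when \<open>a \<psi>\<close> does.\<close>

lemma eigenvalue_nonneg:
  assumes "\<psi> \<in> D" "idem k *\<^sub>T \<psi> = \<psi>" "\<psi> \<noteq> 0" "ad (a \<psi>) = \<nu> *\<^sub>T \<psi>"
  shows "proj k \<nu> \<in> \<real>" "Re (proj k \<nu>) \<ge> 0" "Re (proj k \<nu>) > 0 \<longleftrightarrow> a \<psi> \<noteq> 0"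
proof -
  \<comment> \<open>The lowered ket stays in component \<open>k\<close>, so
    \<open>ip_norm_pos\<close> applies to it as well.\<close>
  have a: "idem k *\<^sub>T a \<psi> = a \<psi>"
    using assms a_scale by metis
  have eq: "proj k (ip (a \<psi>) (a \<psi>)) = proj k \<nu> * proj k (ip \<psi> \<psi>)"
    using ip_lowered assms by simp
  note p = ip_norm_pos[OF assms(1-3)]
  then have eq2: "proj k \<nu> = proj k (ip (a \<psi>) (a \<psi>)) / proj k (ip \<psi> \<psi>)"
    using eq by simp
  have r: "proj k (ip (a \<psi>) (a \<psi>)) \<in> \<real>" "Re (proj k (ip (a \<psi>) (a \<psi>))) \<ge> 0"
    using Dplus_proj ip_Dplus a_closed assms by blast+
  show real: "proj k \<nu> \<in> \<real>"
    using eq2 r p by auto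
  have Re: "Re (proj k (ip (a \<psi>) (a \<psi>))) = Re (proj k \<nu>) * Re (proj k (ip \<psi> \<psi>))"
    using eq real p(1) by (simp add: complex_is_Real_iff)
  then show "Re (proj k \<nu>) \<ge> 0"
    using r p by (simp add: zero_le_mult_iff)
  show "Re (proj k \<nu>) > 0 \<longleftrightarrow> a \<psi> \<noteq> 0"
    using Re p(2) ip_norm_pos(2)[of "a \<psi>" k] a assms
    by (metis a_closed ip_zero(1) D_closed(1) proj_arith(1) zero_complex.simps(1) zero_less_mult_pos2 mult_pos_pos less_irrefl)
qed

lemma lowering_power:
  assumes "\<psi> \<in> D" "idem k *\<^sub>T \<psi> = \<psi>" "ad (a \<psi>) = \<nu> *\<^sub>T \<psi>"
  shows "(a ^^ n) \<psi> \<in> D \<and> idem k *\<^sub>T (a ^^ n) \<psi> = (a ^^ n) \<psi> \<and>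
         ad (a ((a ^^ n) \<psi>)) = (\<nu> - of_nat n * \<xi>) *\<^sub>T (a ^^ n) \<psi>"
proof (induction n)
  case (Suc n)
  have eq: "\<nu> - of_nat n * \<xi> - \<xi> = \<nu> - of_nat (Suc n) * \<xi>"
    by (simp add: algebra_simps)
  then show ?case
    using lowered_eigen[of "(a ^^ n) \<psi>" "\<nu> - of_nat n * \<xi>", unfolded eq]
      a_scale[of "(a ^^ n) \<psi>" "idem k"] Suc
    by auto
qed (use assms in auto)

text \<open>Each lowering step decreases the eigenvalue of \<open>ad \<circ> a\<close> by \<open>xi k\<close>, while it stays
  nonnegative on nonzero kets.\<close>

lemma lowering_terminates:
  assumes k: "k \<in> {1, 2}" and "\<psi> \<in> D" "idem k *\<^sub>T \<psi> = \<psi>" "\<psi> \<noteq> 0" "ad (a \<psi>) = \<nu> *\<^sub>T \<psi>"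
    and n: "n = (LEAST n. Re (proj k \<nu>) - real n * xi k \<le> 0)"
  shows "(a ^^ n) \<psi> \<noteq> 0" "a ((a ^^ n) \<psi>) = 0"
proof -
  note pow = lowering_power[OF assms(2,3,5)]
  have proj_n: "Re (proj k (\<nu> - of_nat n * \<xi>)) = Re (proj k \<nu>) - real n * xi k" for n
    using proj_xi[OF k] by simp
  obtain j :: nat where "Re (proj k \<nu>) / xi k \<le> real j"
    using real_arch_simple by blast
  then have "Re (proj k \<nu>) - real j * xi k \<le> 0"
    using xi_gt_0[OF k] by (simp add: field_simps)
  then have n_le: "Re (proj k \<nu>) - real n * xi k \<le> 0"
    unfolding n by (rule LeastI)
  have "(a ^^ i) \<psi> \<noteq> 0" if "i \<le> n" for i
    using that
  proof (induction i)
    case (Suc i)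
    \<comment> \<open>Minimality of \<open>n\<close> makes the eigenvalue at every earlier index
      positive, so lowering does not kill the ket there. At \<open>n\<close> itself it is at most 0,
      and the same equivalence forces the lowered ket to be 0.\<close>
    then have "Re (proj k \<nu>) - real i * xi k > 0"
      using not_less_Least[of i "\<lambda>n. Re (proj k \<nu>) - real n * xi k \<le> 0"] n by simp
    then show ?case
      using eigenvalue_nonneg(3)[of "(a ^^ i) \<psi>" k "\<nu> - of_nat i * \<xi>"] pow[of i] Suc proj_n[of i]
      by auto
  qed (use assms in auto)
  then show nz: "(a ^^ n) \<psi> \<noteq> 0" by simp
  show "a ((a ^^ n) \<psi>) = 0"
    using eigenvalue_nonneg(3)[of "(a ^^ n) \<psi>" k "\<nu> - of_nat n * \<xi>"] nz pow[of n] proj_n[of n] n_le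
    by auto
qed

end

section \<open>The chain of kets raised from a ground ket\<close>

lemma not_null_ketD: "\<not> null_ket \<psi> \<Longrightarrow> k \<in> {1, 2} \<Longrightarrow> idem k *\<^sub>T \<psi> \<noteq> 0"
  by (auto simp: null_ket_def)

text \<open>Nothing here refers to \<open>E\<close>: the chain is determined by a ground ket and a
  recursion whose constant \<open>rt l\<close> is the componentwise root of
  \<open>(l + 1) \<xi>\<close>.\<close>

locale bicomplex_ladder_ground = bicomplex_ladder D ip a ad \<xi> xi
  for D :: "'v::bicomplex_module set" and ip a ad \<xi> xi +
  fixes rt :: "nat \<Rightarrow> bicomplex" and \<phi> :: "nat \<Rightarrow> 'v"
  assumes rt_eq: "rt l = of_real (sqrt ((real l + 1) * xi 1)) * bc_e1
                        + of_real (sqrt ((real l + 1) * xi 2)) * bc_e2"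
    and ground_in: "\<phi> 0 \<in> D" and ground: "a (\<phi> 0) = 0" and ground_not_null: "\<not> null_ket (\<phi> 0)"
    and raise: "\<phi> (Suc l) = inverse (rt l) *\<^sub>T ad (\<phi> l)"
begin

text \<open>Kept general because the ground ket need not be normalized; only one conclusion of the
  theorem sets its square to 1.\<close>

definition \<kappa> where "\<kappa> = ip (\<phi> 0) (\<phi> 0)"

lemma phi_in [simp]: "\<phi> l \<in> D"
  by (induction l) (auto simp: raise ground_in)

lemma xi_not_null: "\<xi> \<notin> null_cone"
  using xi_pos by (auto simp: xi_eq null_cone_def)

lemma rt_not_null: "rt l \<notin> null_cone"
  using xi_pos by (auto simp: rt_eq null_cone_def)

lemma rt_square: "rt l * rt l = (of_nat l + 1) * \<xi>"
proof -
  have "complex_of_real (sqrt r) * of_real (sqrt r) = of_real r" if "r \<ge> 0" for r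
    using that by (simp flip: of_real_mult)
  from this[of "(real l + 1) * xi 1"] this[of "(real l + 1) * xi 2"] show ?thesis
    using xi_pos by (intro bicomplex_eqI) (simp_all add: rt_eq xi_eq del: real_sqrt_mult)
qed

lemma dagger_inverse_rt: "dagger (inverse (rt l)) = inverse (rt l)"
  by (rule bicomplex_eqI) (simp_all add: rt_eq)

lemma number_eigen: "ad (a (\<phi> l)) = (of_nat l * \<xi>) *\<^sub>T \<phi> l"
proof (induction l)
  case 0
  \<comment> \<open>Homogeneity with the scalar 0 yields \<open>ad 0 = 0\<close>.\<close>
  then show ?case using ad_scale[of 0 0] by (simp add: ground)
next
  case (Suc l)
  have "of_nat l * \<xi> + \<xi> = of_nat (Suc l) * \<xi>"
    by (simp add: algebra_simps)
  then have "ad (a (ad (\<phi> l))) = (of_nat (Suc l) * \<xi>) *\<^sub>T ad (\<phi> l)"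
    using raised_eigen[OF phi_in Suc] by simp
  then show ?case
    by (simp only: raise a_scale ad_scale a_closed ad_closed phi_in scaleT_scaleT mult.commute)
qed

text \<open>The commutator and \<open>number_eigen\<close> give \<open>a (ad (\<phi> l))\<close> the
  factor \<open>(l + 1) \<xi>\<close>, which is \<open>rt l * rt l\<close>; the normalization
  removes one of the two roots.\<close>

lemma lower: "a (\<phi> (Suc l)) = rt l *\<^sub>T \<phi> l"
proof -
  have "inverse (rt l) * ((of_nat l + 1) * \<xi>) = (rt l * inverse (rt l)) * rt l"
    unfolding rt_square[symmetric] by (simp only: mult_ac)
  then have "inverse (rt l) * (of_nat l * \<xi> + \<xi>) = rt l"
    using bicomplex_right_inverse[OF rt_not_null[of l]] by (simp add: algebra_simps)
  moreover have "a (\<phi> (Suc l)) = (inverse (rt l) * (of_nat l * \<xi> + \<xi>)) *\<^sub>T \<phi> l"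
    by (simp only: raise a_scale ad_closed phi_in commutator number_eigen scaleT_scaleT
        flip: scaleT_add_left)
  ultimately show ?thesis
    by simp
qed

lemma raise': "ad (\<phi> l) = rt l *\<^sub>T \<phi> (Suc l)"
  by (simp add: raise scaleT_scaleT bicomplex_right_inverse rt_not_null scaleT_one)

text \<open>Raising multiplies the square by \<open>(l + 1) \<xi>\<close>. As
  \<open>inverse (rt l)\<close> is fixed by \<open>dagger\<close>, it enters twice and cancels this
  factor, which is why the recursion is normalized by \<open>rt l\<close>.\<close>

lemma ip_phi_same: "ip (\<phi> l) (\<phi> l) = \<kappa>"
proof (induction l)
  case (Suc l)
  have "ip (\<phi> (Suc l)) (\<phi> (Suc l)) = inverse (rt l) * inverse (rt l) * (of_nat l * \<xi> + \<xi>) * \<kappa>"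
    by (simp add: raise ip_right ip_left dagger_inverse_rt ip_raised[OF phi_in number_eigen] Suc mult_ac)
  also have "of_nat l * \<xi> + \<xi> = rt l * rt l"
    by (simp add: rt_square algebra_simps)
  also have "inverse (rt l) * inverse (rt l) * (rt l * rt l) = (rt l * inverse (rt l)) * (rt l * inverse (rt l))"
    by (simp only: mult_ac)
  finally show ?case
    using bicomplex_right_inverse[OF rt_not_null[of l]] by simp
qed (simp add: \<kappa>_def)

text \<open>The map \<open>ad \<circ> a\<close> is symmetric with eigenvalues fixed by
  \<open>dagger\<close>, so the difference of two eigenvalues annihilates the product; a nonzero
  real multiple of \<open>\<xi>\<close> is a unit.\<close>

lemma ip_phi_diff:
  assumes "l \<noteq> l'" shows "ip (\<phi> l) (\<phi> l') = 0"
proof -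
  have "dagger (of_nat l * \<xi>) = of_nat l * \<xi>" for l
    by (rule bicomplex_eqI) (simp_all add: xi_eq)
  then have "(of_nat l' * \<xi>) * ip (\<phi> l) (\<phi> l') = (of_nat l * \<xi>) * ip (\<phi> l) (\<phi> l')"
    by (metis adjoint adjoint' number_eigen ip_right(2) ip_left(2) phi_in a_closed ad_closed)
  then have "(of_real (real l' - real l) * \<xi>) * ip (\<phi> l) (\<phi> l') = 0"
    by (simp add: algebra_simps)
  moreover have "of_real (real l' - real l) * \<xi> \<notin> null_cone"
    using xi_not_null assms by (auto simp: null_cone_def)
  ultimately show ?thesis
    using null_cone_mult_cancel by blast
qed

lemma kappa_Dplus: "\<kappa> \<in> Dplus"
  by (simp add: \<kappa>_def ip_Dplus)

text \<open>A ground ket outside the null cone has two nonzero components, and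
  \<open>ip_norm_pos\<close> applies to each of them.\<close>

lemma kappa_not_null: "\<kappa> \<notin> null_cone"
proof -
  have "proj k \<kappa> \<noteq> 0" if k: "k \<in> {1, 2}" for k
    using ip_norm_pos(3)[of "idem k *\<^sub>T \<phi> 0" k] not_null_ketD[OF ground_not_null k]
    by (simp add: scaleT_scaleT ip_left ip_right \<kappa>_def)
  from this[of 1] this[of 2] show ?thesis
    by (simp add: null_cone_def proj_simps)
qed

text \<open>Invertibility of the common square \<open>\<kappa>\<close> carries the nonvanishing of
  both components from the ground ket to every \<open>\<phi> l\<close>.\<close>

lemma idem_phi_nonzero: "idem k *\<^sub>T \<phi> l \<noteq> 0"
proof
  assume "idem k *\<^sub>T \<phi> l = 0"
  then have "idem k * \<kappa> = 0"
    using ip_right(2)[of "\<phi> l" "\<phi> l" "idem k"] by (simp add: ip_phi_same)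
  then show False
    using kappa_not_null by (auto simp: idem_mult_eq_0_iff null_cone_def proj_def split: if_splits)
qed

lemma ip_phi_sum:
  assumes "finite L"
  shows "ip (\<phi> l) (\<Sum>l\<in>L. w l *\<^sub>T \<phi> l) = (if l \<in> L then w l * \<kappa> else 0)"
proof -
  have "ip (\<phi> l) (\<Sum>l\<in>L. w l *\<^sub>T \<phi> l) = (\<Sum>i\<in>L. if i = l then w i * \<kappa> else 0)"
    unfolding ip_sum_right[OF assms phi_in D_closed(3)[OF phi_in]] ip_right(2)[OF phi_in phi_in]
    by (rule sum.cong) (auto simp: ip_phi_same ip_phi_diff)
  then show ?thesis
    using assms by (simp add: sum.delta)
qed

text \<open>Up to the factor \<open>\<kappa>\<close> this is the formula specifying the new product;
  the comparison shows that the formula does not depend on the chosen coefficients.\<close>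

lemma ip_sums:
  assumes "finite L"
  shows "ip (\<Sum>l\<in>L. w l *\<^sub>T \<phi> l) (\<Sum>l\<in>L. v l *\<^sub>T \<phi> l) = \<kappa> * (\<Sum>l\<in>L. dagger (w l) * v l)"
proof -
  have "(\<Sum>l\<in>L. v l *\<^sub>T \<phi> l) \<in> D"
    by (simp add: bcm.subspace_sum[OF subspace])
  then have "ip (\<Sum>l\<in>L. w l *\<^sub>T \<phi> l) (\<Sum>l\<in>L. v l *\<^sub>T \<phi> l) = (\<Sum>l\<in>L. dagger (w l) * (v l * \<kappa>))"
    using assms by (auto simp: ip_sum_left ip_left ip_phi_sum intro!: sum.cong)
  then show ?thesis
    by (simp add: sum_distrib_left mult_ac)
qed

section \<open>Basis and infinite dimension of the span\<close>

lemma inj_phi: "inj \<phi>"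
proof (rule injI, rule ccontr)
  fix l l' assume "\<phi> l = \<phi> l'" "l \<noteq> l'"
  then have "\<kappa> = 0"
    using ip_phi_diff[of l l'] ip_phi_same[of l] by simp
  then show False
    using kappa_not_null by (simp add: null_cone_def)
qed

lemma phi_coefficients_unique:
  assumes "finite L" "(\<Sum>l\<in>L. w l *\<^sub>T \<phi> l) = 0" "l \<in> L"
  shows "w l = 0"
  using ip_phi_sum[OF assms(1), of l w] assms null_cone_mult_cancel[OF kappa_not_null, of "w l"]
  by (simp add: mult.commute)

lemma independent_phi: "bcm.independent (range \<phi>)"
proof
  assume "bcm.dependent (range \<phi>)"
  then obtain t u v where t: "finite t" "t \<subseteq> range \<phi>" "(\<Sum>v\<in>t. u v *\<^sub>T v) = 0" "v \<in> t" "u v \<noteq> 0"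
    unfolding bcm.dependent_explicit by blast
  then obtain L where L: "t = \<phi> ` L" "finite L"
    by (meson finite_subset_image)
  obtain l where "l \<in> L" "v = \<phi> l"
    using t L by blast
  \<comment> \<open>Injectivity of \<open>\<phi>\<close> turns a sum over a set of kets into a sum
    over indices, to which orthogonality applies.\<close>
  moreover have "(\<Sum>l\<in>L. u (\<phi> l) *\<^sub>T \<phi> l) = 0"
    using t(3) unfolding L(1) by (simp add: sum.reindex[OF inj_on_subset[OF inj_phi subset_UNIV]])
  ultimately show False
    using phi_coefficients_unique[OF L(2), of "\<lambda>l. u (\<phi> l)"] t(5) by blast
qed

lemma sum_in_span_phi: "(\<Sum>l\<in>L. w l *\<^sub>T \<phi> l) \<in> bcm.span (\<phi> ` L)"
  by (intro bcm.span_sum bcm.span_scale bcm.span_base imageI)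

lemma span_phi: "bcm.span (range \<phi>) = {\<Sum>l\<in>L. w l *\<^sub>T \<phi> l | L w. finite L}"
proof (intro subset_antisym subsetI)
  fix \<psi> assume "\<psi> \<in> bcm.span (range \<phi>)"
  then obtain t r where t: "finite t" "t \<subseteq> range \<phi>" "\<psi> = (\<Sum>v\<in>t. r v *\<^sub>T v)"
    unfolding bcm.span_explicit by blast
  then obtain L where L: "t = \<phi> ` L" "finite L"
    by (meson finite_subset_image)
  have "\<psi> = (\<Sum>l\<in>L. r (\<phi> l) *\<^sub>T \<phi> l)"
    using t(3) unfolding L(1) by (simp add: sum.reindex[OF inj_on_subset[OF inj_phi subset_UNIV]])
  then show "\<psi> \<in> {\<Sum>l\<in>L. w l *\<^sub>T \<phi> l | L w. finite L}"
    using L(2) by (intro CollectI exI[of _ L] exI[of _ "\<lambda>l. r (\<phi> l)"]) auto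
next
  fix \<psi> assume "\<psi> \<in> {\<Sum>l\<in>L. w l *\<^sub>T \<phi> l | L w. finite L}"
  then show "\<psi> \<in> bcm.span (range \<phi>)"
    using sum_in_span_phi bcm.span_mono[OF image_mono[OF subset_UNIV]] by blast
qed

lemma span_phi_in: "bcm.span (range \<phi>) \<subseteq> D"
  by (rule bcm.span_minimal[OF _ subspace]) auto

text \<open>The kets of \<open>D\<close> orthogonal to \<open>\<phi> l\<close> form a submodule
  containing every other member of the chain, so orthogonality stands in for comparing
  coordinates.\<close>

lemma span_phi_image:
  assumes "\<psi> \<in> bcm.span (\<phi> ` F)" "l \<notin> F" shows "ip (\<phi> l) \<psi> = 0"
proof -
  have "bcm.subspace {\<psi> \<in> D. ip (\<phi> l) \<psi> = 0}"
    by (rule bcm.subspaceI) (auto simp: ip_right)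
  then have "bcm.span (\<phi> ` F) \<subseteq> {\<psi> \<in> D. ip (\<phi> l) \<psi> = 0}"
    using assms(2) by (intro bcm.span_minimal) (auto intro!: ip_phi_diff)
  then show ?thesis
    using assms(1) by auto
qed

lemma finite_subset_span:
  assumes "finite B" "B \<subseteq> bcm.span (range \<phi>)"
  shows "\<exists>F. finite F \<and> B \<subseteq> bcm.span (\<phi> ` F)"
  using assms
proof (induction rule: finite_induct)
  case (insert b B)
  then obtain F where F: "finite F" "B \<subseteq> bcm.span (\<phi> ` F)"
    by auto
  obtain L w where L: "finite L" "b = (\<Sum>l\<in>L. w l *\<^sub>T \<phi> l)"
    using insert span_phi by auto
  then have "b \<in> bcm.span (\<phi> ` L)"
    using sum_in_span_phi by simp
  then have "insert b B \<subseteq> bcm.span (\<phi> ` (F \<union> L))"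
    using F bcm.span_mono[of "\<phi> ` F" "\<phi> ` (F \<union> L)"] bcm.span_mono[of "\<phi> ` L" "\<phi> ` (F \<union> L)"] by auto
  then show ?case
    using F L by blast
qed auto

text \<open>No two bases are compared: a finite generating set would lie in the span of finitely
  many members of the chain, and any further \<open>\<phi> l\<close> would be orthogonal to itself
  although its square is the unit \<open>\<kappa>\<close>.\<close>

lemma infinite_dim: "infinite_dim_free_module (bcm.span (range \<phi>))"
proof -
  have "infinite B" if "is_basis B (bcm.span (range \<phi>))" for B
  proof
    assume "finite B"
    moreover have span: "bcm.span B = bcm.span (range \<phi>)"
      using that by (auto simp: is_basis_def)
    ultimately obtain F where F: "finite F" "B \<subseteq> bcm.span (\<phi> ` F)"
      using finite_subset_span[of B] bcm.span_superset[of B] by blast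
    obtain l where "l \<notin> F"
      using F(1) ex_new_if_finite infinite_UNIV_nat by blast
    moreover have "\<phi> l \<in> bcm.span B"
      using span by (simp add: bcm.span_base)
    ultimately have "ip (\<phi> l) (\<phi> l) = 0"
      using span_phi_image[of "\<phi> l" F l] bcm.span_minimal[OF F(2) bcm.subspace_span] by blast
    then show False
      using ip_phi_same kappa_not_null by (auto simp: null_cone_def)
  qed
  then show ?thesis
    using independent_phi bcm.subspace_span
    unfolding infinite_dim_free_module_def free_module_def is_basis_def by blast
qed

lemma ladder_span:
  assumes "\<psi> \<in> bcm.span (range \<phi>)"
  shows "a \<psi> \<in> bcm.span (range \<phi>)" "ad \<psi> \<in> bcm.span (range \<phi>)"
proof -
  \<comment> \<open>Membership in \<open>D\<close> is included because additivity and homogeneity of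
    the ladder maps are assumed only there.\<close>
  let ?S = "{\<psi> \<in> D. a \<psi> \<in> bcm.span (range \<phi>) \<and> ad \<psi> \<in> bcm.span (range \<phi>)}"
  have "a (\<phi> l) \<in> bcm.span (range \<phi>)" "ad (\<phi> l) \<in> bcm.span (range \<phi>)" for l
    by (cases l; auto simp: ground lower raise' intro: bcm.span_zero bcm.span_scale bcm.span_base)+
  then have "range \<phi> \<subseteq> ?S"
    by auto
  moreover have "bcm.subspace ?S"
    using a_scale[of 0 0] ad_scale[of 0 0]
    by (intro bcm.subspaceI)
       (auto simp: a_add ad_add a_scale ad_scale intro: bcm.span_zero bcm.span_add bcm.span_scale)
  ultimately show "a \<psi> \<in> bcm.span (range \<phi>)" "ad \<psi> \<in> bcm.span (range \<phi>)"
    using bcm.span_minimal[of "range \<phi>" ?S] assms by auto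
qed

section \<open>The scalar product specified on the span\<close>

lemma span_phi_common_index:
  assumes "\<psi> \<in> bcm.span (range \<phi>)" "\<chi> \<in> bcm.span (range \<phi>)"
  obtains L w v where "finite L" "\<psi> = (\<Sum>l\<in>L. w l *\<^sub>T \<phi> l)" "\<chi> = (\<Sum>l\<in>L. v l *\<^sub>T \<phi> l)"
proof -
  obtain L w where L: "finite L" "\<psi> = (\<Sum>l\<in>L. w l *\<^sub>T \<phi> l)"
    using assms(1) span_phi by auto
  obtain K v where K: "finite K" "\<chi> = (\<Sum>l\<in>K. v l *\<^sub>T \<phi> l)"
    using assms(2) span_phi by auto
  \<comment> \<open>Zero coefficients pad both sums to the union of their index sets.\<close>
  have extend: "(\<Sum>l\<in>J. u l *\<^sub>T \<phi> l) = (\<Sum>l\<in>L \<union> K. (if l \<in> J then u l else 0) *\<^sub>T \<phi> l)"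
    if "J \<subseteq> L \<union> K" for u J
    using that L(1) K(1) by (intro sum.mono_neutral_cong_left) auto
  show ?thesis
    using L K extend[of L w] extend[of K v] by (intro that[of "L \<union> K"]) simp_all
qed

text \<open>The formula constrains \<open>ipM\<close> on the span only. As \<open>ipM\<close>
  receives kets and not coefficients, the existence of such a function is the well-definedness of
  the formula.\<close>

definition "orthonormalizes ipM \<longleftrightarrow> (\<forall>L w v. finite L \<longrightarrow>
  ipM (\<Sum>l\<in>L. w l *\<^sub>T \<phi> l) (\<Sum>l\<in>L. v l *\<^sub>T \<phi> l) = (\<Sum>l\<in>L. dagger (w l) * v l))"

lemma inverse_kappa: "inverse \<kappa> * (\<kappa> * w) = w"
proof -
  have "inverse \<kappa> * (\<kappa> * w) = (\<kappa> * inverse \<kappa>) * w"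
    by (simp only: mult_ac)
  then show ?thesis
    using bicomplex_right_inverse[OF kappa_not_null] by simp
qed

lemma orthonormalizes_exists: "orthonormalizes (\<lambda>\<psi> \<chi>. inverse \<kappa> * ip \<psi> \<chi>)"
  unfolding orthonormalizes_def by (simp add: ip_sums inverse_kappa)

lemma orthonormalizes_unique:
  assumes "orthonormalizes ipM" "\<psi> \<in> bcm.span (range \<phi>)" "\<chi> \<in> bcm.span (range \<phi>)"
  shows "ipM \<psi> \<chi> = inverse \<kappa> * ip \<psi> \<chi>"
proof -
  obtain L w v where "finite L" "\<psi> = (\<Sum>l\<in>L. w l *\<^sub>T \<phi> l)" "\<chi> = (\<Sum>l\<in>L. v l *\<^sub>T \<phi> l)"
    using span_phi_common_index[OF assms(2,3)] .
  then show ?thesis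
    using assms(1) by (simp add: orthonormalizes_def ip_sums inverse_kappa)
qed

lemma orthonormalizes_scalar_product:
  assumes "orthonormalizes ipM"
  shows "scalar_product (bcm.span (range \<phi>)) ipM"
proof -
  let ?M = "bcm.span (range \<phi>)"
  note eq = orthonormalizes_unique[OF assms]
  have in_D: "\<psi> \<in> D" if "\<psi> \<in> ?M" for \<psi>
    using that span_phi_in by auto
  show ?thesis
    unfolding scalar_product_def
  proof (intro conjI ballI allI)
    fix \<psi> \<chi> assume M: "\<psi> \<in> ?M" "\<chi> \<in> ?M"
    \<comment> \<open>The factor \<open>inverse \<kappa>\<close> has real components, so conjugation
      passes through it.\<close>
    show "ipM \<psi> \<chi> = dagger (ipM \<chi> \<psi>)"
      unfolding eq[OF M] eq[OF M(2,1)] ip_dagger[OF in_D[OF M(1)] in_D[OF M(2)]]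
      by (simp add: dagger_Dplus[OF Dplus_inverse[OF kappa_Dplus]])
    show "ipM \<psi> (s *\<^sub>T \<chi>) = s * ipM \<psi> \<chi>" for s
      using M by (simp add: eq bcm.span_scale ip_right in_D mult.left_commute)
    show "ipM \<psi> (\<chi> + \<chi>') = ipM \<psi> \<chi> + ipM \<psi> \<chi>'" if "\<chi>' \<in> ?M" for \<chi>'
      using M that by (simp add: eq bcm.span_add ip_right in_D distrib_left)
  next
    fix \<psi> assume M: "\<psi> \<in> ?M"
    have "inverse \<kappa> \<notin> null_cone"
      using kappa_not_null by (simp add: null_cone_def)
    then have "ipM \<psi> \<psi> = 0 \<longleftrightarrow> ip \<psi> \<psi> = 0"
      using null_cone_mult_cancel eq[OF M M] by auto
    then show "ipM \<psi> \<psi> = 0 \<longleftrightarrow> \<psi> = 0"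
      using ip_eq_0_iff in_D[OF M] by blast
  qed
qed

end

section \<open>Partially defined operators\<close>

text \<open>Unlike \<open>linear_operator\<close>, this names no ambient module and no range, so
  sums, multiples and composites inherit it, and with them every word in the ladder
  operators.\<close>

definition partial_linear :: "('v::bicomplex_module \<rightharpoonup> 'v) \<Rightarrow> bool" where
  "partial_linear B \<longleftrightarrow> B 0 = Some 0 \<and>
     (\<forall>\<psi> \<phi> x y. B \<psi> = Some x \<longrightarrow> B \<phi> = Some y \<longrightarrow> B (\<psi> + \<phi>) = Some (x + y)) \<and>
     (\<forall>s \<psi> x. B \<psi> = Some x \<longrightarrow> B (s *\<^sub>T \<psi>) = Some (s *\<^sub>T x))"

lemma partial_linearD:
  assumes "partial_linear B"
  shows "B 0 = Some 0" "B \<psi> = Some x \<Longrightarrow> B \<phi> = Some y \<Longrightarrow> B (\<psi> + \<phi>) = Some (x + y)"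
    "B \<psi> = Some x \<Longrightarrow> B (s *\<^sub>T \<psi>) = Some (s *\<^sub>T x)"
  using assms by (auto simp: partial_linear_def)

lemma partial_linearI:
  assumes "B 0 = Some 0" "\<And>\<psi> \<phi> x y. B \<psi> = Some x \<Longrightarrow> B \<phi> = Some y \<Longrightarrow> B (\<psi> + \<phi>) = Some (x + y)"
    "\<And>s \<psi> x. B \<psi> = Some x \<Longrightarrow> B (s *\<^sub>T \<psi>) = Some (s *\<^sub>T x)"
  shows "partial_linear B"
  using assms by (simp add: partial_linear_def)

lemma linear_operator_partial_linear:
  assumes "linear_operator M B" shows "partial_linear B"
proof -
  have "0 \<in> dom B"
    using assms bcm.subspace_0 unfolding linear_operator_def by blast
  moreover have scale: "B (s *\<^sub>T \<psi>) = Some (s *\<^sub>T the (B \<psi>))" if "\<psi> \<in> dom B" for s \<psi>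
    using assms that unfolding linear_operator_def by blast
  ultimately have "B 0 = Some 0"
    using scale[of 0 0] by simp
  moreover have add: "B (\<psi> + \<phi>) = Some (the (B \<psi>) + the (B \<phi>))" if "\<psi> \<in> dom B" "\<phi> \<in> dom B" for \<psi> \<phi>
    using assms that unfolding linear_operator_def by blast
  ultimately show ?thesis
  proof (intro partial_linearI)
    fix \<psi> \<phi> x y assume "B \<psi> = Some x" "B \<phi> = Some y"
    then show "B (\<psi> + \<phi>) = Some (x + y)"
      using add[of \<psi> \<phi>] by auto
  next
    fix s \<psi> x assume "B \<psi> = Some x"
    then show "B (s *\<^sub>T \<psi>) = Some (s *\<^sub>T x)"
      using scale[of \<psi> s] by auto
  qed
qed

lemma partial_linear_Some: "partial_linear Some"
  by (simp add: partial_linear_def)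

lemma op_scale_apply: "op_scale s B \<psi> = Some y \<longleftrightarrow> (\<exists>x. B \<psi> = Some x \<and> y = s *\<^sub>T x)"
  by (auto simp: op_scale_def)

lemma op_add_apply: "op_add B C \<psi> = Some z \<longleftrightarrow> (\<exists>x y. B \<psi> = Some x \<and> C \<psi> = Some y \<and> z = x + y)"
  by (auto simp: op_add_def split: option.splits)

lemma partial_linear_op_scale: "partial_linear B \<Longrightarrow> partial_linear (op_scale s B)"
  by (rule partial_linearI)
     (auto simp: op_scale_apply partial_linearD scaleT_add_right scaleT_scaleT mult.commute)

lemma partial_linear_op_add: "partial_linear B \<Longrightarrow> partial_linear C \<Longrightarrow> partial_linear (op_add B C)"
  by (rule partial_linearI) (auto simp: op_add_apply partial_linearD scaleT_add_right)

lemma partial_linear_comp: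
  assumes "partial_linear B" "partial_linear C" shows "partial_linear (B \<circ>\<^sub>m C)"
  by (rule partial_linearI) (auto simp: map_comp_Some_iff partial_linearD[OF assms(1)] partial_linearD[OF assms(2)])

lemma partial_linear_ladder:
  assumes "partial_linear X" "partial_linear P"
  shows "partial_linear (lowering_op m \<omega> hbar X P)" "partial_linear (raising_op m \<omega> hbar X P)"
  using assms
  by (auto simp: lowering_op_def raising_op_def intro!: partial_linear_op_scale partial_linear_op_add)

section \<open>Words in two partial operators\<close>

lemma partial_linear_word:
  "(\<And>B. B \<in> set Bs \<Longrightarrow> partial_linear B) \<Longrightarrow> partial_linear (foldr (\<circ>\<^sub>m) Bs Some)"
  by (induction Bs) (auto intro: partial_linear_comp partial_linear_Some simp: id_def)

text \<open>With \<open>foldr\<close> the last letter of a word acts first, so a letter applied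
  before a word is appended on its right.\<close>

lemma word_append_apply:
  assumes "A \<psi> = Some x" shows "foldr (\<circ>\<^sub>m) (Bs @ [A]) Some \<psi> = foldr (\<circ>\<^sub>m) Bs Some x"
  by (induction Bs) (auto simp: assms map_comp_def)

text \<open>The set is the intersection of the domains of all words, and each word is partially
  linear.\<close>

lemma subspace_words_defined:
  assumes "partial_linear A" "partial_linear B"
  shows "bcm.subspace {\<psi>. words_defined_at A B \<psi>}"
proof -
  have "partial_linear (foldr (\<circ>\<^sub>m) Bs Some)" if "set Bs \<subseteq> {A, B}" for Bs
    using that assms by (intro partial_linear_word) auto
  note lin = partial_linearD[OF this]
  show ?thesis
  proof (rule bcm.subspaceI)
    show "0 \<in> {\<psi>. words_defined_at A B \<psi>}"
      using lin(1) unfolding words_defined_at_def by blast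
    show "x + y \<in> {\<psi>. words_defined_at A B \<psi>}"
      if "x \<in> {\<psi>. words_defined_at A B \<psi>}" "y \<in> {\<psi>. words_defined_at A B \<psi>}" for x y
      using that lin(2) unfolding words_defined_at_def mem_Collect_eq by blast
    show "s *\<^sub>T x \<in> {\<psi>. words_defined_at A B \<psi>}" if "x \<in> {\<psi>. words_defined_at A B \<psi>}" for s x
      using that lin(3) unfolding words_defined_at_def mem_Collect_eq by blast
  qed
qed

text \<open>Applying \<open>Bs\<close> after \<open>C\<close> is the word \<open>Bs @ [C]\<close>,
  so both letters carry the set of kets admitting all words into itself.\<close>

lemma words_defined_at_step:
  assumes "words_defined_at A B \<psi>" "C \<in> {A, B}"
  shows "\<exists>x. words_defined_at A B x \<and> C \<psi> = Some x"
proof -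
  have "set [C] \<subseteq> {A, B}"
    using assms(2) by auto
  then have "\<psi> \<in> dom (foldr (\<circ>\<^sub>m) [C] Some)"
    using assms(1) unfolding words_defined_at_def by blast
  then obtain x where x: "C \<psi> = Some x"
    by (auto simp: map_comp_def)
  have "x \<in> dom (foldr (\<circ>\<^sub>m) Bs Some)" if "set Bs \<subseteq> {A, B}" for Bs
  proof -
    have "set (Bs @ [C]) \<subseteq> {A, B}"
      using assms(2) that by auto
    then have "\<psi> \<in> dom (foldr (\<circ>\<^sub>m) (Bs @ [C]) Some)"
      using assms(1) unfolding words_defined_at_def by blast
    then show ?thesis
      unfolding dom_def mem_Collect_eq word_append_apply[where A = C, OF x] .
  qed
  then show ?thesis
    using x by (auto simp: words_defined_at_def)
qed

text \<open>Serves to verify the domain clause of assumption (e) on \<open>M\<close>: evaluating a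
  word never leaves an invariant set.\<close>

lemma words_defined_atI:
  assumes closed: "\<And>\<psi> C. \<psi> \<in> S \<Longrightarrow> C \<in> {A, B} \<Longrightarrow> \<exists>x\<in>S. C \<psi> = Some x" and "\<psi> \<in> S"
  shows "words_defined_at A B \<psi>"
  unfolding words_defined_at_def
proof (intro allI impI)
  fix Bs assume "set Bs \<subseteq> {A, B}"
  then have "\<exists>x\<in>S. foldr (\<circ>\<^sub>m) Bs Some \<psi> = Some x"
  proof (induction Bs)
    case (Cons C Bs)
    then obtain x where "x \<in> S" "foldr (\<circ>\<^sub>m) Bs Some \<psi> = Some x"
      by auto
    then show ?case
      using closed[of x C] Cons.prems by (auto simp: map_comp_Some_iff)
  qed (use \<open>\<psi> \<in> S\<close> in auto)
  then show "\<psi> \<in> dom (foldr (\<circ>\<^sub>m) Bs Some)"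
    by blast
qed

section \<open>Position and momentum recovered from the ladder operators\<close>

lemma lowering_op_apply:
  "lowering_op m \<omega> hbar X P \<psi> = Some y \<longleftrightarrow> (\<exists>x q. X \<psi> = Some x \<and> P \<psi> = Some q \<and>
     y = of_real (1 / sqrt (2 * m * hbar * \<omega>)) *\<^sub>T (of_real (m * \<omega>) *\<^sub>T x + bc_i1 *\<^sub>T q))"
  by (auto simp: lowering_op_def op_scale_apply op_add_apply)

lemma raising_op_apply:
  "raising_op m \<omega> hbar X P \<psi> = Some y \<longleftrightarrow> (\<exists>x q. X \<psi> = Some x \<and> P \<psi> = Some q \<and>
     y = of_real (1 / sqrt (2 * m * hbar * \<omega>)) *\<^sub>T (of_real (m * \<omega>) *\<^sub>T x + (- bc_i1) *\<^sub>T q))"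
  by (auto simp: raising_op_def op_scale_apply op_add_apply)

lemma scaleT_cancel:
  assumes "s \<notin> null_cone" "s *\<^sub>T x = y" shows "x = inverse s *\<^sub>T y"
  using assms bicomplex_right_inverse[OF assms(1)] by (auto simp: scaleT_scaleT scaleT_one mult.commute)

text \<open>The sum and the difference of the ladder images are \<open>2 * c * d\<close> times the
  position image and \<open>2 * c * bc_i1\<close> times the momentum image; both factors are units,
  so a submodule containing the ladder images contains these too.\<close>

lemma position_momentum_closed:
  assumes pos: "m > 0" "\<omega> > 0" "hbar > 0" and "bcm.subspace S"
    and y: "lowering_op m \<omega> hbar X P \<psi> = Some y" "y \<in> S"
    and z: "raising_op m \<omega> hbar X P \<psi> = Some z" "z \<in> S"
  shows "\<exists>x\<in>S. X \<psi> = Some x" "\<exists>x\<in>S. P \<psi> = Some x"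
proof -
  define c where "c = (of_real (1 / sqrt (2 * m * hbar * \<omega>)) :: bicomplex)"
  define d where "d = (of_real (m * \<omega>) :: bicomplex)"
  obtain x q where xq: "X \<psi> = Some x" "P \<psi> = Some q"
    "y = c *\<^sub>T (d *\<^sub>T x + bc_i1 *\<^sub>T q)" "z = c *\<^sub>T (d *\<^sub>T x + (- bc_i1) *\<^sub>T q)"
    using y(1) z(1) by (auto simp: lowering_op_apply raising_op_apply c_def d_def)
  have two: "2 * c * s = c * s + c * s" for s
    by (simp only: mult_2 distrib_right)
  have "y + z = (2 * c * d) *\<^sub>T x"
    unfolding two[of d] scaleT_add_left by (simp add: xq scaleT_add_right scaleT_scaleT bcm.scale_right_diff_distrib)
  moreover have "2 * c * d \<notin> null_cone"
    using pos by (simp add: c_def d_def null_cone_def)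
  ultimately have "x = inverse (2 * c * d) *\<^sub>T (y + z)"
    by (intro scaleT_cancel) simp_all
  also have "\<dots> \<in> S"
    by (intro bcm.subspace_scale[OF assms(4)] bcm.subspace_add[OF assms(4)] y z)
  finally have "x \<in> S" .
  then show "\<exists>x\<in>S. X \<psi> = Some x"
    using xq by blast
  have "y - z = (2 * c * bc_i1) *\<^sub>T q"
    unfolding two[of bc_i1] scaleT_add_left by (simp add: xq scaleT_add_right scaleT_scaleT bcm.scale_right_diff_distrib)
  moreover have "2 * c * bc_i1 \<notin> null_cone"
    using pos by (simp add: c_def d_def null_cone_def)
  ultimately have "q = inverse (2 * c * bc_i1) *\<^sub>T (y - z)"
    by (intro scaleT_cancel) simp_all
  also have "\<dots> \<in> S"
    by (intro bcm.subspace_scale[OF assms(4)] bcm.subspace_diff[OF assms(4)] y z)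
  finally have "q \<in> S" .
  then show "\<exists>x\<in>S. P \<psi> = Some x"
    using xq by blast
qed

text \<open>The submodule \<open>S\<close> is a parameter because two instances occur:
  \<open>D\<close>, to obtain the ladder algebra, and the span \<open>M\<close>, to restrict the
  operators.\<close>

locale canonical_pair =
  fixes m \<omega> hbar :: real and \<xi> :: bicomplex
    and X P :: "'v::bicomplex_module \<rightharpoonup> 'v" and S :: "'v set"
  assumes pos: "m > 0" "\<omega> > 0" "hbar > 0"
    and lin: "partial_linear X" "partial_linear P"
    and comm: "commutation_relation hbar \<xi> X P"
    and subspace_S: "bcm.subspace S"
    and X_S: "\<psi> \<in> S \<Longrightarrow> \<exists>x\<in>S. X \<psi> = Some x"
    and P_S: "\<psi> \<in> S \<Longrightarrow> \<exists>x\<in>S. P \<psi> = Some x"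
begin

text \<open>Total functions standing for the partial operators on \<open>S\<close>; outside
  \<open>S\<close> the value of \<open>the\<close> may carry no information, so the rules below
  assume membership in \<open>S\<close>.\<close>

definition "x \<psi> = the (X \<psi>)"
definition "p \<psi> = the (P \<psi>)"
definition "c = (of_real (1 / sqrt (2 * m * hbar * \<omega>)) :: bicomplex)"
definition "d = (of_real (m * \<omega>) :: bicomplex)"
definition "lower \<psi> = the (lowering_op m \<omega> hbar X P \<psi>)"
definition "raise \<psi> = the (raising_op m \<omega> hbar X P \<psi>)"
definition "energy \<psi> = of_real (1 / (2 * m)) *\<^sub>T p (p \<psi>) + of_real (1 / 2 * m * \<omega>^2) *\<^sub>T x (x \<psi>)"

lemma S_closed:
  "0 \<in> S" "\<psi> \<in> S \<Longrightarrow> \<phi> \<in> S \<Longrightarrow> \<psi> + \<phi> \<in> S" "\<psi> \<in> S \<Longrightarrow> s *\<^sub>T \<psi> \<in> S" "\<psi> \<in> S \<Longrightarrow> \<phi> \<in> S \<Longrightarrow> \<psi> - \<phi> \<in> S"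
  using subspace_S by (auto intro: bcm.subspace_0 bcm.subspace_add bcm.subspace_scale bcm.subspace_diff)

lemma X_apply: "\<psi> \<in> S \<Longrightarrow> X \<psi> = Some (x \<psi>)" and x_in: "\<psi> \<in> S \<Longrightarrow> x \<psi> \<in> S"
  using X_S by (fastforce simp: x_def)+

lemma P_apply: "\<psi> \<in> S \<Longrightarrow> P \<psi> = Some (p \<psi>)" and p_in: "\<psi> \<in> S \<Longrightarrow> p \<psi> \<in> S"
  using P_S by (fastforce simp: p_def)+

lemma x_add: "\<psi> \<in> S \<Longrightarrow> \<phi> \<in> S \<Longrightarrow> x (\<psi> + \<phi>) = x \<psi> + x \<phi>"
  and x_scale: "\<psi> \<in> S \<Longrightarrow> x (s *\<^sub>T \<psi>) = s *\<^sub>T x \<psi>"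
  by (simp_all add: x_def[of "_ + _"] x_def[of "_ *\<^sub>T _"] partial_linearD[OF lin(1)] X_apply)

lemma p_add: "\<psi> \<in> S \<Longrightarrow> \<phi> \<in> S \<Longrightarrow> p (\<psi> + \<phi>) = p \<psi> + p \<phi>"
  and p_scale: "\<psi> \<in> S \<Longrightarrow> p (s *\<^sub>T \<psi>) = s *\<^sub>T p \<psi>"
  by (simp_all add: p_def[of "_ + _"] p_def[of "_ *\<^sub>T _"] partial_linearD[OF lin(2)] P_apply)

lemma lowering_apply: "\<psi> \<in> S \<Longrightarrow> lowering_op m \<omega> hbar X P \<psi> = Some (lower \<psi>)"
  and lower_eq: "\<psi> \<in> S \<Longrightarrow> lower \<psi> = c *\<^sub>T (d *\<^sub>T x \<psi> + bc_i1 *\<^sub>T p \<psi>)"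
proof -
  assume "\<psi> \<in> S"
  then have "lowering_op m \<omega> hbar X P \<psi> = Some (c *\<^sub>T (d *\<^sub>T x \<psi> + bc_i1 *\<^sub>T p \<psi>))"
    by (simp add: lowering_op_apply X_apply P_apply c_def d_def)
  then show "lowering_op m \<omega> hbar X P \<psi> = Some (lower \<psi>)" "lower \<psi> = c *\<^sub>T (d *\<^sub>T x \<psi> + bc_i1 *\<^sub>T p \<psi>)"
    by (simp_all add: lower_def)
qed

lemma raising_apply: "\<psi> \<in> S \<Longrightarrow> raising_op m \<omega> hbar X P \<psi> = Some (raise \<psi>)"
  and raise_eq: "\<psi> \<in> S \<Longrightarrow> raise \<psi> = c *\<^sub>T (d *\<^sub>T x \<psi> + (- bc_i1) *\<^sub>T p \<psi>)"
proof -
  assume "\<psi> \<in> S"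
  then have "raising_op m \<omega> hbar X P \<psi> = Some (c *\<^sub>T (d *\<^sub>T x \<psi> + (- bc_i1) *\<^sub>T p \<psi>))"
    by (simp add: raising_op_apply X_apply P_apply c_def d_def)
  then show "raising_op m \<omega> hbar X P \<psi> = Some (raise \<psi>)" "raise \<psi> = c *\<^sub>T (d *\<^sub>T x \<psi> + (- bc_i1) *\<^sub>T p \<psi>)"
    by (simp_all add: raise_def)
qed

lemma op_power_2_apply:
  assumes "B \<psi> = Some y" "B y = Some z" shows "op_power B 2 \<psi> = Some z"
  using assms by (simp add: op_power_def numeral_2_eq_2 map_comp_def)

lemma hamiltonian_apply: "\<psi> \<in> S \<Longrightarrow> oscillator_hamiltonian m \<omega> X P \<psi> = Some (energy \<psi>)"
  unfolding oscillator_hamiltonian_def op_add_apply op_scale_apply energy_def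
  using op_power_2_apply[of X \<psi> "x \<psi>" "x (x \<psi>)"] op_power_2_apply[of P \<psi> "p \<psi>" "p (p \<psi>)"]
  by (auto simp: X_apply P_apply x_in p_in)

lemma energy_in: "\<psi> \<in> S \<Longrightarrow> energy \<psi> \<in> S"
  by (simp add: energy_def S_closed x_in p_in)

lemma lower_in: "\<psi> \<in> S \<Longrightarrow> lower \<psi> \<in> S" and raise_in: "\<psi> \<in> S \<Longrightarrow> raise \<psi> \<in> S"
  by (simp_all add: lower_eq raise_eq S_closed x_in p_in)

lemma ladder_linear:
  "\<psi> \<in> S \<Longrightarrow> \<phi> \<in> S \<Longrightarrow> lower (\<psi> + \<phi>) = lower \<psi> + lower \<phi>" "\<psi> \<in> S \<Longrightarrow> lower (s *\<^sub>T \<psi>) = s *\<^sub>T lower \<psi>"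
  "\<psi> \<in> S \<Longrightarrow> \<phi> \<in> S \<Longrightarrow> raise (\<psi> + \<phi>) = raise \<psi> + raise \<phi>" "\<psi> \<in> S \<Longrightarrow> raise (s *\<^sub>T \<psi>) = s *\<^sub>T raise \<psi>"
  by (simp_all add: lower_eq raise_eq S_closed x_add p_add x_scale p_scale scaleT_add_right scaleT_scaleT mult_ac
      add_ac del: bcm.scale_minus_left)

lemma xp_comm: "\<psi> \<in> S \<Longrightarrow> x (p \<psi>) = p (x \<psi>) + (bc_i1 * of_real hbar * \<xi>) *\<^sub>T \<psi>"
proof -
  assume S: "\<psi> \<in> S"
  then have XP: "(X \<circ>\<^sub>m P) \<psi> = Some (x (p \<psi>))" "(P \<circ>\<^sub>m X) \<psi> = Some (p (x \<psi>))"
    by (simp_all add: map_comp_def X_apply P_apply x_in p_in)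
  then have "\<psi> \<in> dom (X \<circ>\<^sub>m P) \<inter> dom (P \<circ>\<^sub>m X)"
    by blast
  with comm have "the ((X \<circ>\<^sub>m P) \<psi>) - the ((P \<circ>\<^sub>m X) \<psi>) = (bc_i1 * of_real hbar * \<xi>) *\<^sub>T \<psi>"
    unfolding commutation_relation_def by blast
  then have "x (p \<psi>) - p (x \<psi>) = (bc_i1 * of_real hbar * \<xi>) *\<^sub>T \<psi>"
    by (simp only: XP option.sel)
  then show ?thesis
    by (simp add: algebra_simps)
qed

text \<open>These match the terms of \<open>raise (lower \<psi>)\<close>: the first two are the
  coefficients of the potential and the kinetic part of the energy divided by
  \<open>hbar * \<omega>\<close>, the third reduces the commutator term to half of
  \<open>\<xi>\<close>.\<close>

lemma coefficients:
  "c * c * d * d = of_real (1 / (hbar * \<omega>)) * of_real (1 / 2 * m * \<omega>^2)"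
  "c * c = of_real (1 / (hbar * \<omega>)) * of_real (1 / (2 * m))"
  "c * c * d * of_real hbar = of_real (1/2)"
proof -
  have *: "1 / sqrt (2 * m * hbar * \<omega>) * (1 / sqrt (2 * m * hbar * \<omega>)) = 1 / (2 * m * hbar * \<omega>)"
    using pos by simp
  show "c * c * d * d = of_real (1 / (hbar * \<omega>)) * of_real (1 / 2 * m * \<omega>^2)"
    "c * c = of_real (1 / (hbar * \<omega>)) * of_real (1 / (2 * m))"
    "c * c * d * of_real hbar = of_real (1/2)"
    unfolding c_def d_def of_real_mult[symmetric] *
    using pos by (simp_all add: field_simps power2_eq_square del: of_real_mult of_real_divide)
qed

text \<open>On expanding, the square terms give the energy, and the mixed terms of
  \<open>raise (lower \<psi>)\<close> collapse to the commutator with factor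
  \<open>c * c * d * bc_i1\<close>, which by \<open>bc_i1 * bc_i1 = -1\<close> is minus half of
  \<open>\<xi>\<close>. The opposite order flips only the sign of the mixed terms.\<close>

lemma raise_lower:
  assumes S: "\<psi> \<in> S"
  shows "raise (lower \<psi>) = of_real (1 / (hbar * \<omega>)) *\<^sub>T energy \<psi> - (of_real (1/2) * \<xi>) *\<^sub>T \<psi>"
    and "lower (raise \<psi>) = of_real (1 / (hbar * \<omega>)) *\<^sub>T energy \<psi> + (of_real (1/2) * \<xi>) *\<^sub>T \<psi>"
proof -
  note ss = S_closed x_in p_in x_add x_scale p_add p_scale scaleT_add_right scaleT_scaleT S
  have e: "of_real (1 / (hbar * \<omega>)) *\<^sub>T energy \<psi> = (c * c * d * d) *\<^sub>T x (x \<psi>) + (c * c) *\<^sub>T p (p \<psi>)"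
    unfolding coefficients(1) unfolding coefficients(2) energy_def scaleT_add_right scaleT_scaleT by (simp only: add.commute)
  have s: "- (c * c * d * bc_i1 * (bc_i1 * of_real hbar * \<xi>)) = of_real (1/2) * \<xi>"
  proof -
    have "- (c * c * d * bc_i1 * (bc_i1 * of_real hbar * \<xi>)) = - (bc_i1 * bc_i1) * (c * c * d * of_real hbar) * \<xi>"
      by (simp only: mult_ac minus_mult_left minus_mult_right)
    then show ?thesis
      unfolding bicomplex_units(1) coefficients(3) by simp
  qed
  have i: "c * bc_i1 * c * bc_i1 = - (c * c)"
    using bicomplex_units(1) by (metis mult.assoc mult.commute mult_minus1)
  have "raise (lower \<psi>) = (c * c * d * d) *\<^sub>T x (x \<psi>) + (c * c * d * bc_i1) *\<^sub>T x (p \<psi>)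
      + (- (c * c * d * bc_i1)) *\<^sub>T p (x \<psi>) + (- (c * bc_i1 * c * bc_i1)) *\<^sub>T p (p \<psi>)"
    by (simp add: lower_eq raise_eq ss mult_ac add_ac del: bcm.scale_minus_left)
  also have "\<dots> = (c * c * d * d) *\<^sub>T x (x \<psi>) + (c * c) *\<^sub>T p (p \<psi>) +
      (c * c * d * bc_i1 * (bc_i1 * of_real hbar * \<xi>)) *\<^sub>T \<psi>"
    unfolding i xp_comm[OF S] scaleT_add_right scaleT_scaleT by simp
  finally show "raise (lower \<psi>) = of_real (1 / (hbar * \<omega>)) *\<^sub>T energy \<psi> - (of_real (1/2) * \<xi>) *\<^sub>T \<psi>"
    unfolding e s[symmetric] by simp
  have "lower (raise \<psi>) = (c * c * d * d) *\<^sub>T x (x \<psi>) + (- (c * c * d * bc_i1)) *\<^sub>T x (p \<psi>)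
      + (c * c * d * bc_i1) *\<^sub>T p (x \<psi>) + (- (c * bc_i1 * c * bc_i1)) *\<^sub>T p (p \<psi>)"
    by (simp add: lower_eq raise_eq ss mult_ac add_ac del: bcm.scale_minus_left)
  also have "\<dots> = (c * c * d * d) *\<^sub>T x (x \<psi>) + (c * c) *\<^sub>T p (p \<psi>) -
      (c * c * d * bc_i1 * (bc_i1 * of_real hbar * \<xi>)) *\<^sub>T \<psi>"
    unfolding i xp_comm[OF S] scaleT_add_right scaleT_scaleT by simp
  finally show "lower (raise \<psi>) = of_real (1 / (hbar * \<omega>)) *\<^sub>T energy \<psi> + (of_real (1/2) * \<xi>) *\<^sub>T \<psi>"
    unfolding e s[symmetric] by simp
qed

lemma commutator: "\<psi> \<in> S \<Longrightarrow> lower (raise \<psi>) = raise (lower \<psi>) + \<xi> *\<^sub>T \<psi>"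
proof -
  have "\<xi> = of_real (1/2) * \<xi> + of_real (1/2) * \<xi>"
    by (rule bicomplex_eqI) simp_all
  then have "\<xi> *\<^sub>T \<psi> = (of_real (1/2) * \<xi>) *\<^sub>T \<psi> + (of_real (1/2) * \<xi>) *\<^sub>T \<psi>"
    by (simp add: flip: scaleT_add_left)
  then show "\<psi> \<in> S \<Longrightarrow> ?thesis"
    by (simp add: raise_lower)
qed

lemma eigen_from_number:
  assumes "\<psi> \<in> S" "raise (lower \<psi>) = \<nu> *\<^sub>T \<psi>"
  shows "energy \<psi> = (of_real (hbar * \<omega>) * (\<nu> + of_real (1/2) * \<xi>)) *\<^sub>T \<psi>"
proof -
  have "of_real (1 / (hbar * \<omega>)) *\<^sub>T energy \<psi> = (\<nu> + of_real (1/2) * \<xi>) *\<^sub>T \<psi>"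
    using raise_lower(1)[OF assms(1)] assms(2) by (simp add: scaleT_add_left)
  then have "of_real (hbar * \<omega>) *\<^sub>T of_real (1 / (hbar * \<omega>)) *\<^sub>T energy \<psi> = of_real (hbar * \<omega>) *\<^sub>T (\<nu> + of_real (1/2) * \<xi>) *\<^sub>T \<psi>"
    by simp
  then show ?thesis
    using pos by (simp add: scaleT_scaleT scaleT_one flip: of_real_mult del: of_real_divide)
qed

text \<open>Conjugation turns \<open>- bc_i1\<close> into \<open>bc_i1\<close> and fixes the real
  scalars \<open>c\<close> and \<open>d\<close>; conjugate-linearity in the first argument comes
  from Hermitian symmetry.\<close>

lemma adjoint:
  assumes sp: "scalar_product S ip" and sa: "self_adjoint ip X" "self_adjoint ip P"
    and S: "\<psi> \<in> S" "\<phi> \<in> S"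
  shows "ip \<psi> (lower \<phi>) = ip (raise \<psi>) \<phi>"
proof -
  have add: "ip \<psi> (\<phi> + \<chi>) = ip \<psi> \<phi> + ip \<psi> \<chi>" if "\<psi> \<in> S" "\<phi> \<in> S" "\<chi> \<in> S" for \<psi> \<phi> \<chi>
    using sp that unfolding scalar_product_def by blast
  have scale: "ip \<psi> (s *\<^sub>T \<phi>) = s * ip \<psi> \<phi>" if "\<psi> \<in> S" "\<phi> \<in> S" for \<psi> \<phi> s
    using sp that unfolding scalar_product_def by blast
  have herm: "ip \<psi> \<phi> = dagger (ip \<phi> \<psi>)" if "\<psi> \<in> S" "\<phi> \<in> S" for \<psi> \<phi>
    using sp that unfolding scalar_product_def by blast
  have "ip (raise \<psi>) \<phi> = dagger (c * (d * ip \<phi> (x \<psi>) + (- bc_i1) * ip \<phi> (p \<psi>)))"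
    unfolding herm[OF raise_in[OF S(1)] S(2)]
    using S by (simp only: raise_eq add scale S_closed x_in p_in)
  also have "\<dots> = c * (d * ip (x \<psi>) \<phi> + bc_i1 * ip (p \<psi>) \<phi>)"
    using S by (simp add: herm[of "x \<psi>"] herm[of "p \<psi>"] x_in p_in c_def d_def del: of_real_mult of_real_divide)
  also have "ip (x \<psi>) \<phi> = ip \<psi> (x \<phi>)"
    using sa(1) domI[where m = X, OF X_apply[OF S(1)]] domI[where m = X, OF X_apply[OF S(2)]]
    unfolding self_adjoint_def x_def by metis
  also have "ip (p \<psi>) \<phi> = ip \<psi> (p \<phi>)"
    using sa(2) domI[where m = P, OF P_apply[OF S(1)]] domI[where m = P, OF P_apply[OF S(2)]]
    unfolding self_adjoint_def p_def by metis
  finally show ?thesis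
    using S by (simp only: lower_eq add scale S_closed x_in p_in)
qed

text \<open>Invariance of \<open>S\<close> lets the squares be computed inside \<open>S\<close>, and
  outside it both sides are undefined. Assumption (a) on \<open>M\<close> asks for the Hamiltonian
  built from the restricted operators.\<close>

lemma hamiltonian_restrict:
  "oscillator_hamiltonian m \<omega> (X |` S) (P |` S) = oscillator_hamiltonian m \<omega> X P |` S"
proof
  fix \<psi>
  show "oscillator_hamiltonian m \<omega> (X |` S) (P |` S) \<psi> = (oscillator_hamiltonian m \<omega> X P |` S) \<psi>"
  proof (cases "\<psi> \<in> S")
    case True
    then have "op_power (X |` S) 2 \<psi> = Some (x (x \<psi>))" "op_power (P |` S) 2 \<psi> = Some (p (p \<psi>))"
      by (auto intro!: op_power_2_apply simp: X_apply P_apply x_in p_in)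
    then have "oscillator_hamiltonian m \<omega> (X |` S) (P |` S) \<psi> = Some (energy \<psi>)"
      unfolding oscillator_hamiltonian_def op_add_apply op_scale_apply energy_def by blast
    then show ?thesis
      using True by (simp add: hamiltonian_apply)
  next
    case False
    then show ?thesis
      by (simp add: oscillator_hamiltonian_def op_add_def op_scale_def op_power_def numeral_2_eq_2 map_comp_def)
  qed
qed

lemma ladder_restrict:
  assumes "\<psi> \<in> S"
  shows "lowering_op m \<omega> hbar (X |` S) (P |` S) \<psi> = Some (lower \<psi>)"
    "raising_op m \<omega> hbar (X |` S) (P |` S) \<psi> = Some (raise \<psi>)"
  using assms lowering_apply[OF assms] raising_apply[OF assms]
  by (simp_all add: lowering_op_apply raising_op_apply)

end

section \<open>Restriction to an invariant submodule\<close>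

lemma linear_operator_restrict:
  assumes B: "partial_linear B" and S: "bcm.subspace S" and closed: "\<And>\<psi>. \<psi> \<in> S \<Longrightarrow> \<exists>x\<in>S. B \<psi> = Some x"
  shows "linear_operator S (B |` S)"
proof -
  have dom: "dom (B |` S) = S"
    using closed by (auto simp: dom_restrict)
  have ran: "ran (B |` S) \<subseteq> S"
    using closed by (fastforce simp: ran_def restrict_map_def split: if_splits)
  have "(B |` S) (\<psi> + \<phi>) = Some (the ((B |` S) \<psi>) + the ((B |` S) \<phi>))" if "\<psi> \<in> S" "\<phi> \<in> S" for \<psi> \<phi>
    using that closed[OF that(1)] closed[OF that(2)] bcm.subspace_add[OF S that]
    by (auto simp: partial_linearD[OF B])
  moreover have "(B |` S) (s *\<^sub>T \<psi>) = Some (s *\<^sub>T the ((B |` S) \<psi>))" if "\<psi> \<in> S" for \<psi> s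
    using that closed[OF that(1)] bcm.subspace_scale[OF S that] by (auto simp: partial_linearD[OF B])
  ultimately show ?thesis
    unfolding linear_operator_def dom using S ran by blast
qed

text \<open>Invariance of \<open>S\<close> keeps the image kets where the two products are
  proportional, so the same factor \<open>s\<close> multiplies both sides.\<close>

lemma self_adjoint_restrict:
  assumes sa: "self_adjoint ip B" and closed: "\<And>\<psi>. \<psi> \<in> S \<Longrightarrow> \<exists>x\<in>S. B \<psi> = Some x"
    and ip': "\<And>\<psi> \<phi>. \<psi> \<in> S \<Longrightarrow> \<phi> \<in> S \<Longrightarrow> ip' \<psi> \<phi> = s * ip \<psi> \<phi>"
  shows "self_adjoint ip' (B |` S)"
  unfolding self_adjoint_def
proof (intro ballI)
  fix \<psi> \<phi> assume "\<psi> \<in> dom (B |` S)" "\<phi> \<in> dom (B |` S)"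
  then have S: "\<psi> \<in> S" "\<phi> \<in> S" and dom: "\<psi> \<in> dom B" "\<phi> \<in> dom B"
    by auto
  obtain x y where xy: "x \<in> S" "B \<psi> = Some x" "y \<in> S" "B \<phi> = Some y"
    using closed[OF S(1)] closed[OF S(2)] by blast
  have "ip \<psi> (the (B \<phi>)) = ip (the (B \<psi>)) \<phi>"
    using sa dom unfolding self_adjoint_def by blast
  then show "ip' \<psi> (the ((B |` S) \<phi>)) = ip' (the ((B |` S) \<psi>)) \<phi>"
    using S xy by (simp add: ip')
qed

text \<open>Composites of restrictions have smaller domains and the same values there.\<close>

lemma commutation_relation_restrict:
  assumes "commutation_relation hbar \<xi> X P"
  shows "commutation_relation hbar \<xi> (X |` S) (P |` S)"
  unfolding commutation_relation_def
proof
  have sub: "(f \<circ>\<^sub>m g) \<psi> = Some y" if "((f |` S) \<circ>\<^sub>m (g |` S)) \<psi> = Some y" for f g :: "'a \<rightharpoonup> 'a" and \<psi> y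
    using that by (auto simp: map_comp_Some_iff restrict_map_def split: if_splits)
  fix \<psi> assume "\<psi> \<in> dom ((X |` S) \<circ>\<^sub>m (P |` S)) \<inter> dom ((P |` S) \<circ>\<^sub>m (X |` S))"
  then obtain y z where yz: "((X |` S) \<circ>\<^sub>m (P |` S)) \<psi> = Some y" "((P |` S) \<circ>\<^sub>m (X |` S)) \<psi> = Some z"
    by blast
  then have XP: "(X \<circ>\<^sub>m P) \<psi> = Some y" "(P \<circ>\<^sub>m X) \<psi> = Some z"
    using sub by blast+
  then have "\<psi> \<in> dom (X \<circ>\<^sub>m P) \<inter> dom (P \<circ>\<^sub>m X)"
    by blast
  then have "the ((X \<circ>\<^sub>m P) \<psi>) - the ((P \<circ>\<^sub>m X) \<psi>) = (bc_i1 * of_real hbar * \<xi>) *\<^sub>T \<psi>"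
    using assms unfolding commutation_relation_def by blast
  then show "the (((X |` S) \<circ>\<^sub>m (P |` S)) \<psi>) - the (((P |` S) \<circ>\<^sub>m (X |` S)) \<psi>)
      = (bc_i1 * of_real hbar * \<xi>) *\<^sub>T \<psi>"
    by (simp only: XP yz)
qed

text \<open>On a ket of component \<open>k\<close> the repeated factor \<open>idem k\<close> is
  absorbed because \<open>b\<close> commutes with it, so powers of the component operator become
  powers of the total map \<open>b\<close>.\<close>

lemma op_power_idem:
  assumes B: "\<And>\<psi>. \<psi> \<in> D \<Longrightarrow> B \<psi> = Some (b \<psi>)" "\<And>\<psi>. \<psi> \<in> D \<Longrightarrow> b \<psi> \<in> D"
      "\<And>\<psi>. \<psi> \<in> D \<Longrightarrow> b (idem k *\<^sub>T \<psi>) = idem k *\<^sub>T b \<psi>"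
    and \<psi>: "\<psi> \<in> D" "idem k *\<^sub>T \<psi> = \<psi>"
  shows "op_power (op_scale (idem k) B) n \<psi> = Some ((b ^^ n) \<psi>)" "(b ^^ n) \<psi> \<in> D"
    "idem k *\<^sub>T (b ^^ n) \<psi> = (b ^^ n) \<psi>"
proof -
  have "op_power (op_scale (idem k) B) n \<psi> = Some ((b ^^ n) \<psi>) \<and> (b ^^ n) \<psi> \<in> D \<and>
    idem k *\<^sub>T (b ^^ n) \<psi> = (b ^^ n) \<psi>"
  proof (induction n)
    case 0
    then show ?case using \<psi> by (simp add: op_power_def)
  next
    case (Suc n)
    have "idem k *\<^sub>T b ((b ^^ n) \<psi>) = b ((b ^^ n) \<psi>)"
      using B(3)[of "(b ^^ n) \<psi>"] Suc by simp
    then show ?case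
      using Suc B(1,2) by (simp add: op_power_def op_scale_def map_comp_def)
  qed
  then show "op_power (op_scale (idem k) B) n \<psi> = Some ((b ^^ n) \<psi>)" "(b ^^ n) \<psi> \<in> D"
    "idem k *\<^sub>T (b ^^ n) \<psi> = (b ^^ n) \<psi>"
    by blast+
qed

text \<open>Lets the real normalization constants of the two components be merged into the single
  bicomplex scalar \<open>inverse (rt l)\<close>.\<close>

lemma scaleT_idem_cong:
  assumes "idem k *\<^sub>T \<psi> = \<psi>" "proj k s = proj k t" shows "s *\<^sub>T \<psi> = t *\<^sub>T \<psi>"
proof -
  have "idem k * (s - t) = 0"
    using assms(2) by (simp add: idem_mult_eq_0_iff)
  then have "s * idem k = t * idem k"
    by (simp add: algebra_simps)
  then show ?thesis
    using assms(1) scaleT_scaleT by metis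
qed

lemma scalar_product_subset:
  assumes "scalar_product M ip" "S \<subseteq> M" shows "scalar_product S ip"
proof -
  note sp = assms(1)[unfolded scalar_product_def]
  show ?thesis
    unfolding scalar_product_def
  proof (intro conjI)
    show "\<forall>\<psi>\<in>S. \<forall>\<phi>\<in>S. \<forall>\<chi>\<in>S. ip \<psi> (\<phi> + \<chi>) = ip \<psi> \<phi> + ip \<psi> \<chi>"
      using sp[THEN conjunct1] assms(2) by blast
    show "\<forall>\<psi>\<in>S. \<forall>\<phi>\<in>S. \<forall>s. ip \<psi> (s *\<^sub>T \<phi>) = s * ip \<psi> \<phi>"
      using sp[THEN conjunct2, THEN conjunct1] assms(2) by blast
    show "\<forall>\<psi>\<in>S. \<forall>\<phi>\<in>S. ip \<psi> \<phi> = dagger (ip \<phi> \<psi>)"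
      using sp[THEN conjunct2, THEN conjunct2, THEN conjunct1] assms(2) by blast
    show "\<forall>\<psi>\<in>S. ip \<psi> \<psi> = 0 \<longleftrightarrow> \<psi> = 0"
      using sp[THEN conjunct2, THEN conjunct2, THEN conjunct2] assms(2) by blast
  qed
qed

theorem mainTheorem2:
  fixes m \<omega> hbar :: real
    and \<xi> Ev :: bicomplex
    and xi :: "nat \<Rightarrow> real"
    and M0 M :: "'v::bicomplex_module set"
    and ip :: "'v \<Rightarrow> 'v \<Rightarrow> bicomplex"
    and X P H A Astar :: "'v \<rightharpoonup> 'v"
    and Ak Astark :: "nat \<Rightarrow> 'v \<rightharpoonup> 'v"
    and E :: 'v
    and level :: "nat \<Rightarrow> nat"
    and \<phi>0 :: "nat \<Rightarrow> 'v"
    and \<phi>k :: "nat \<Rightarrow> nat \<Rightarrow> 'v"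
    and \<phi> :: "nat \<Rightarrow> 'v"
    and rt :: "nat \<Rightarrow> bicomplex"
  assumes pos: "m > 0" "\<omega> > 0" "hbar > 0"
    and oscillator: "bicomplex_oscillator M0 ip m \<omega> hbar \<xi> X P H E Ev"
    and xi: "xi 1 > 0" "xi 2 > 0" "\<xi> = of_real (xi 1) * bc_e1 + of_real (xi 2) * bc_e2"
    and A_eq: "A = lowering_op m \<omega> hbar X P"
    and Astar_eq: "Astar = raising_op m \<omega> hbar X P"
    and Ak_eq: "Ak = (\<lambda>k. op_scale (idem k) A)"
    and Astark_eq: "Astark = (\<lambda>k. op_scale (idem k) Astar)"
    and level_eq: "level = (\<lambda>k. LEAST n.
          Re (proj k Ev) / (hbar * \<omega>) - (real n + 1/2) * xi k \<le> 0)"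
    and \<phi>0_eq: "\<phi>0 = (\<lambda>k. the (op_power (Ak k) (level k) (idem k *\<^sub>T E)))"
    and \<phi>k_eq: "\<phi>k = (\<lambda>k l.
          of_real ((fact l * xi k ^ l) powr (-1/2)) *\<^sub>T the (op_power (Astark k) l (\<phi>0 k)))"
    and \<phi>_eq: "\<phi> = (\<lambda>l. \<phi>k 1 l + \<phi>k 2 l)"
    and M_eq: "M = {\<Sum>l\<in>L. w l *\<^sub>T \<phi> l | (L :: nat set) (w :: nat \<Rightarrow> bicomplex). finite L}"
    and rt_eq: "rt = (\<lambda>l. of_real (sqrt ((real l + 1) * xi 1)) * bc_e1
                        + of_real (sqrt ((real l + 1) * xi 2)) * bc_e2)"
  shows
    "(\<forall>k\<in>{1,2}. proj k Ev \<in> \<real>)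
     \<and> (\<forall>k\<in>{1,2}. idem k *\<^sub>T E \<in> dom (op_power (Ak k) (level k)) \<and> Ak k (\<phi>0 k) = Some 0)
     \<and> (\<forall>k\<in>{1,2}. \<forall>l. \<phi>0 k \<in> dom (op_power (Astark k) l) \<and> \<phi>k k l \<noteq> 0)
     \<and> (\<forall>l. eigenket H (\<phi> l) (of_real ((real l + 1/2) * hbar * \<omega>) * \<xi>))
     \<and> (\<forall>l l'. l \<noteq> l' \<longrightarrow> ip (\<phi> l) (\<phi> l') = 0)
     \<and> bcm.subspace M \<and> M \<subseteq> dom H
     \<and> (\<forall>l. map_option (scaleT (1 / rt l)) (Astar (\<phi> l)) = Some (\<phi> (Suc l))
            \<and> A (\<phi> (Suc l)) = Some (rt l *\<^sub>T \<phi> l))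
     \<and> M \<subseteq> dom A \<and> M \<subseteq> dom Astar \<and> M \<subseteq> dom X \<and> M \<subseteq> dom P
     \<and> (ip (\<phi> 0) (\<phi> 0) = 1 \<longrightarrow>
          (\<forall>l. ip (\<phi> l) (\<phi> l) = 1)
          \<and> (\<forall>L w v. finite L \<longrightarrow>
               (\<Sum>l\<in>L. dagger (w l) * v l * ip (\<phi> l) (\<phi> l)) = (\<Sum>l\<in>L. dagger (w l) * v l)))
     \<and> bcm.span (range \<phi>) = M \<and> inj \<phi> \<and> bcm.independent (range \<phi>)
     \<and> infinite_dim_free_module M
     \<and> (let defining = (\<lambda>ipM :: 'v \<Rightarrow> 'v \<Rightarrow> bicomplex. \<forall>L w v. finite L \<longrightarrow>
               ipM (\<Sum>l\<in>L. w l *\<^sub>T \<phi> l) (\<Sum>l\<in>L. v l *\<^sub>T \<phi> l) = (\<Sum>l\<in>L. dagger (w l) * v l))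
        in (\<exists>ipM. defining ipM)
           \<and> (\<forall>ipM. defining ipM \<longrightarrow> scalar_product M ipM
                \<and> (\<exists>E' Ev'. bicomplex_oscillator M ipM m \<omega> hbar \<xi> (X |` M) (P |` M) (H |` M) E' Ev')))"
proof -
  define lower where "lower = canonical_pair.lower m \<omega> hbar X P"
  define raise where "raise = canonical_pair.raise m \<omega> hbar X P"
  define energy where "energy = canonical_pair.energy m \<omega> X P"
  define D where "D = {\<psi>. words_defined_at A Astar \<psi>}"
  note defs = lower_def raise_def energy_def
  note osc = oscillator[unfolded bicomplex_oscillator_def]
  have lin: "linear_operator M0 X" "linear_operator M0 P" "linear_operator M0 H"
    and H_eq: "H = oscillator_hamiltonian m \<omega> X P"
    and sp: "scalar_product M0 ip" "self_adjoint ip X" "self_adjoint ip P" "self_adjoint ip H"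
    and Dplus: "\<And>\<psi>. \<psi> \<in> M0 \<Longrightarrow> ip \<psi> \<psi> \<in> Dplus"
    and comm: "\<xi> \<notin> null_cone" "commutation_relation hbar \<xi> X P"
    and E: "eigenket H E Ev" "\<not> null_ket E" "words_defined_at A Astar E"
    and orth: "\<And>\<psi> \<phi> s t. eigenket H \<psi> s \<Longrightarrow> eigenket H \<phi> t \<Longrightarrow> \<not> null_ket \<psi> \<Longrightarrow> \<not> null_ket \<phi> \<Longrightarrow>
        s - t \<notin> null_cone \<Longrightarrow> ip \<psi> \<phi> = 0"
    using osc unfolding A_eq Astar_eq by blast+
  note pl = lin[THEN linear_operator_partial_linear]
  have pl_ladder: "partial_linear A" "partial_linear Astar"
    unfolding A_eq Astar_eq using partial_linear_ladder pl by blast+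
  have subspace_D: "bcm.subspace D"
    unfolding D_def using subspace_words_defined pl_ladder by blast
  have step: "\<exists>x\<in>D. A \<psi> = Some x" "\<exists>x\<in>D. Astar \<psi> = Some x" if "\<psi> \<in> D" for \<psi>
    using words_defined_at_step[of A Astar \<psi>] that unfolding D_def by blast+
  interpret pair: canonical_pair m \<omega> hbar \<xi> X P D
  proof
    fix \<psi> assume "\<psi> \<in> D"
    then obtain y z where "A \<psi> = Some y" "y \<in> D" "Astar \<psi> = Some z" "z \<in> D"
      using step by blast
    then show "\<exists>x\<in>D. X \<psi> = Some x" "\<exists>x\<in>D. P \<psi> = Some x"
      using position_momentum_closed[OF pos subspace_D] unfolding A_eq Astar_eq by blast+
  qed (use pos pl comm subspace_D in auto)
  have A_apply: "A \<psi> = Some (lower \<psi>)" and Astar_apply: "Astar \<psi> = Some (raise \<psi>)"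
    and H_apply: "H \<psi> = Some (energy \<psi>)" if "\<psi> \<in> D" for \<psi>
    using that pair.lowering_apply pair.raising_apply pair.hamiltonian_apply
    by (simp_all add: A_eq Astar_eq H_eq defs)
  have "D \<subseteq> M0"
    using pair.X_apply lin(1) unfolding linear_operator_def by blast
  then have sp_D: "scalar_product D ip"
    using scalar_product_subset sp(1) by blast
  interpret lad: bicomplex_ladder D ip lower raise \<xi> xi
  proof
    show "ip \<psi> (lower \<phi>) = ip (raise \<psi>) \<phi>" if "\<psi> \<in> D" "\<phi> \<in> D" for \<psi> \<phi>
      unfolding defs using pair.adjoint sp_D sp that by blast
  qed (use subspace_D sp_D Dplus \<open>D \<subseteq> M0\<close> xi in
      \<open>auto simp: defs pair.lower_in pair.raise_in pair.ladder_linear pair.commutator\<close>)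

  \<comment> \<open>The eigenvalue of \<open>raise \<circ> lower\<close> at \<open>E\<close>, read
    off from \<open>raise_lower\<close>.\<close>
  define \<nu> where "\<nu> = of_real (1 / (hbar * \<omega>)) * Ev - of_real (1/2) * \<xi>"
  have E_in: "E \<in> D"
    using E by (simp add: D_def)
  have "energy E = Ev *\<^sub>T E"
    using E(1) H_apply[OF E_in] by (simp add: eigenket_def)
  then have E_number: "raise (lower E) = \<nu> *\<^sub>T E"
    using pair.raise_lower(1)[OF E_in]
    by (simp add: defs \<nu>_def scaleT_scaleT bcm.scale_left_diff_distrib)
  have proj_\<nu>: "proj k \<nu> = proj k Ev / of_real (hbar * \<omega>) - of_real (xi k / 2)" if "k \<in> {1, 2}" for k
    using lad.proj_xi[OF that] by (simp add: \<nu>_def)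
  have Ek: "idem k *\<^sub>T E \<in> D" "idem k *\<^sub>T idem k *\<^sub>T E = idem k *\<^sub>T E"
    "raise (lower (idem k *\<^sub>T E)) = \<nu> *\<^sub>T idem k *\<^sub>T E" for k
    using E_in E_number by (simp_all add: scaleT_scaleT lad.a_scale lad.ad_scale mult.commute)
  \<comment> \<open>Reality of the components makes the \<open>Re\<close> in \<open>level\<close>
    faithful to the order comparison in the theorem.\<close>
  have Ev_real: "proj k Ev \<in> \<real>" if k: "k \<in> {1, 2}" for k
  proof -
    have "proj k \<nu> \<in> \<real>"
      using lad.eigenvalue_nonneg(1)[OF Ek(1,2) _ Ek(3)] not_null_ketD[OF E(2) k] by blast
    moreover have "proj k Ev = (proj k \<nu> + of_real (xi k / 2)) * of_real (hbar * \<omega>)"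
      using proj_\<nu>[OF k] pos by simp
    ultimately show ?thesis
      by (metis Reals_add Reals_mult Reals_of_real)
  qed
  \<comment> \<open>The term with half of \<open>\<xi>\<close> is already part of
    \<open>\<nu>\<close>, so the shift by 1/2 disappears and \<open>level k\<close> takes the form
    in which \<open>lowering_terminates\<close> counts steps.\<close>
  have level: "level k = (LEAST n. Re (proj k \<nu>) - real n * xi k \<le> 0)" if "k \<in> {1, 2}" for k
    unfolding level_eq proj_\<nu>[OF that] by (simp add: algebra_simps)
  note power_A = op_power_idem[where B = A and b = lower and D = D, OF A_apply lad.a_closed lad.a_scale Ek(1,2)]
  have \<phi>0: "op_power (Ak k) (level k) (idem k *\<^sub>T E) = Some (\<phi>0 k)" "\<phi>0 k \<in> D" "idem k *\<^sub>T \<phi>0 k = \<phi>0 k"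
    and \<phi>0_pow: "\<phi>0 k = (lower ^^ level k) (idem k *\<^sub>T E)" for k
    using power_A[where k = k and n = "level k"] by (simp_all add: \<phi>0_eq Ak_eq)
  have \<phi>0_ground: "lower (\<phi>0 k) = 0" "\<phi>0 k \<noteq> 0" if k: "k \<in> {1, 2}" for k
    using lad.lowering_terminates[OF k Ek(1,2) not_null_ketD[OF E(2) k] Ek(3) level[OF k]]
    by (simp_all add: \<phi>0_pow)
  have Ak_\<phi>0: "Ak k (\<phi>0 k) = Some 0" if "k \<in> {1, 2}" for k
    using \<phi>0_ground[OF that] A_apply[OF \<phi>0(2)] by (simp add: Ak_eq op_scale_def)
  note power_Astar = op_power_idem[where B = Astar and b = raise and D = D, OF Astar_apply lad.ad_closed lad.ad_scale \<phi>0(2,3)]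
  define u where "u k l = (raise ^^ l) (\<phi>0 k)" for k l
  have u: "op_power (Astark k) l (\<phi>0 k) = Some (u k l)" "u k l \<in> D" "idem k *\<^sub>T u k l = u k l" for k l
    using power_Astar[where k = k and n = l] by (simp_all add: u_def Astark_eq)
  have u_Suc: "u k (Suc l) = raise (u k l)" for k l
    by (simp add: u_def)
  define r where "r k l = (fact l * xi k ^ l) powr (-1/2)" for k l
  have \<phi>k: "\<phi>k k l = of_real (r k l) *\<^sub>T u k l" for k l
    by (simp add: \<phi>k_eq r_def u)
  have idem_\<phi>k: "idem k *\<^sub>T \<phi>k k l = \<phi>k k l" for k l
    using u(3)[of k l] by (metis \<phi>k scaleT_scaleT mult.commute)
  \<comment> \<open>Converts the closed normalization constant of the statement into the recursion
    that the chain locale expects.\<close>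
  have r_Suc: "r k (Suc l) = r k l / sqrt ((real l + 1) * xi k)" if "k \<in> {1, 2}" for k l
  proof -
    have xi_k: "xi k > 0"
      using lad.xi_gt_0[OF that] .
    have "fact (Suc l) * xi k ^ Suc l = (fact l * xi k ^ l) * ((real l + 1) * xi k)"
      by (simp add: algebra_simps)
    then have "r k (Suc l) = r k l * ((real l + 1) * xi k) powr (- (1/2))"
      unfolding r_def using xi_k by (simp only: powr_mult) simp
    also have "((real l + 1) * xi k) powr (- (1/2)) = 1 / sqrt ((real l + 1) * xi k)"
      using xi_k unfolding powr_minus_divide by (subst powr_half_sqrt) auto
    finally show ?thesis
      by simp
  qed
  have proj_rt: "proj k (rt l) = of_real (sqrt ((real l + 1) * xi k))" if "k \<in> {1, 2}" for k l
    using that by (auto simp: rt_eq proj_def simp del: real_sqrt_mult)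
  have \<phi>k_Suc: "\<phi>k k (Suc l) = inverse (rt l) *\<^sub>T raise (\<phi>k k l)" if "k \<in> {1, 2}" for k l
  proof -
    have "\<phi>k k (Suc l) = (inverse (rt l) * of_real (r k l)) *\<^sub>T u k (Suc l)"
      unfolding \<phi>k using that
      by (intro scaleT_idem_cong[OF u(3)])
         (simp add: r_Suc proj_rt divide_inverse mult.commute del: real_sqrt_mult)
    then show ?thesis
      by (simp add: \<phi>k u u_Suc lad.ad_scale scaleT_scaleT)
  qed
  have \<phi>k_in: "\<phi>k k l \<in> D" for k l
    by (simp add: \<phi>k u)
  have r_0: "r k 0 = 1" for k
    by (simp add: r_def)
  have \<phi>k_0: "\<phi>k k 0 = \<phi>0 k" for k
    by (simp add: \<phi>k u_def r_0 scaleT_one)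
  have e1e2: "bc_e1 * bc_e2 = 0" "bc_e2 * bc_e1 = 0"
    using bicomplex_idempotents by (simp_all add: mult.commute)
  \<comment> \<open>The mixed products of the idempotents vanish, so multiplying by
    \<open>idem k\<close> extracts one summand.\<close>
  have idem_\<phi>: "idem k *\<^sub>T \<phi> l = \<phi>k k l" if "k \<in> {1, 2}" for k l
  proof -
    have "bc_e1 *\<^sub>T \<phi>k 2 l = bc_e1 *\<^sub>T bc_e2 *\<^sub>T \<phi>k 2 l" "bc_e2 *\<^sub>T \<phi>k 1 l = bc_e2 *\<^sub>T bc_e1 *\<^sub>T \<phi>k 1 l"
      using idem_\<phi>k[of 2 l] idem_\<phi>k[of 1 l] by simp_all
    then have "bc_e1 *\<^sub>T \<phi>k 2 l = 0" "bc_e2 *\<^sub>T \<phi>k 1 l = 0"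
      by (simp_all only: scaleT_scaleT e1e2 bcm.scale_zero_left)
    then show ?thesis
      using that idem_\<phi>k[of 2 l] idem_\<phi>k[of 1 l] by (auto simp: \<phi>_eq scaleT_add_right)
  qed
  \<comment> \<open>The two components of \<open>\<phi> 0\<close> may come from different numbers of
    lowering steps, yet both are nonzero and killed by \<open>lower\<close>, so their sum is a
    ground ket outside the null cone.\<close>
  interpret gr: bicomplex_ladder_ground D ip lower raise \<xi> xi rt \<phi>
  proof
    show "\<phi> 0 \<in> D"
      by (simp add: \<phi>_eq \<phi>k_in)
    show "lower (\<phi> 0) = 0"
      using \<phi>0_ground(1)[of 1] \<phi>0_ground(1)[of 2] by (simp add: \<phi>_eq \<phi>k_0 lad.a_add \<phi>0)
    have "idem k *\<^sub>T \<phi> 0 \<noteq> 0" if "k \<in> {1, 2}" for k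
      using idem_\<phi>[OF that] \<phi>k_0 \<phi>0_ground(2)[OF that] by simp
    from this[of 1] this[of 2] show "\<not> null_ket (\<phi> 0)"
      by (simp add: null_ket_def)
    show "\<phi> (Suc l) = inverse (rt l) *\<^sub>T raise (\<phi> l)" for l
      using \<phi>k_Suc[of 1 l] \<phi>k_Suc[of 2 l] by (simp add: \<phi>_eq lad.ad_add \<phi>k_in scaleT_add_right)
  qed (simp add: rt_eq)

  have M_span: "M = bcm.span (range \<phi>)"
    unfolding M_eq gr.span_phi by (rule refl)
  have subspace_M: "bcm.subspace M"
    unfolding M_span by (rule bcm.subspace_span)
  have M_D: "M \<subseteq> D"
    unfolding M_span by (rule gr.span_phi_in)
  \<comment> \<open>The span is closed under the ladder maps, hence under position and
    momentum.\<close>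
  interpret pairM: canonical_pair m \<omega> hbar \<xi> X P M
  proof
    fix \<psi> assume \<psi>: "\<psi> \<in> M"
    then have "A \<psi> = Some (lower \<psi>)" "lower \<psi> \<in> M" "Astar \<psi> = Some (raise \<psi>)" "raise \<psi> \<in> M"
      using M_D A_apply Astar_apply gr.ladder_span unfolding M_span by blast+
    then show "\<exists>x\<in>M. X \<psi> = Some x" "\<exists>x\<in>M. P \<psi> = Some x"
      using position_momentum_closed[OF pos subspace_M] unfolding A_eq Astar_eq by blast+
  qed (use pos pl comm subspace_M in auto)
  have \<phi>_M: "\<phi> l \<in> M" for l
    unfolding M_span by (simp add: bcm.span_base)
  have H_M: "\<exists>x\<in>M. H \<psi> = Some x" if "\<psi> \<in> M" for \<psi>
    using pairM.hamiltonian_apply[OF that] pairM.energy_in[OF that] by (simp add: H_eq)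
  have not_null: "\<not> null_ket (\<phi> l)" for l
    using gr.idem_phi_nonzero[of 1 l] gr.idem_phi_nonzero[of 2 l] by (simp add: null_ket_def)
  have \<phi>_nonzero: "\<phi> l \<noteq> 0" for l
    using not_null[of l] by (auto simp: null_ket_def)
  have eigen: "eigenket H (\<phi> l) (of_real ((real l + 1/2) * hbar * \<omega>) * \<xi>)" for l
  proof -
    have "of_real (hbar * \<omega>) * (of_nat l * \<xi> + of_real (1/2) * \<xi>) = of_real ((real l + 1/2) * hbar * \<omega>) * \<xi>"
      by (rule bicomplex_eqI) (simp_all add: algebra_simps)
    then have "energy (\<phi> l) = (of_real ((real l + 1/2) * hbar * \<omega>) * \<xi>) *\<^sub>T \<phi> l"
      using pair.eigen_from_number[OF gr.phi_in gr.number_eigen[unfolded defs]] by (simp only: defs)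
    then show ?thesis
      by (simp add: eigenket_def \<phi>_nonzero H_apply)
  qed
  \<comment> \<open>The ground ket, whose eigenvalue is half of \<open>hbar * \<omega>\<close> times
    \<open>\<xi>\<close>, takes the role of the eigenket of assumption (e) on
    \<open>M\<close>.\<close>
  have restrict: "bicomplex_oscillator M ipM m \<omega> hbar \<xi> (X |` M) (P |` M) (H |` M) (\<phi> 0)
      (of_real ((real 0 + 1/2) * hbar * \<omega>) * \<xi>)"
    if ipM: "gr.orthonormalizes ipM" for ipM
  proof -
    have eq: "ipM \<psi> \<chi> = inverse gr.\<kappa> * ip \<psi> \<chi>" if "\<psi> \<in> M" "\<chi> \<in> M" for \<psi> \<chi>
      using gr.orthonormalizes_unique[OF ipM] that unfolding M_span .
    have "ipM \<psi> \<psi> \<in> Dplus" if "\<psi> \<in> M" for \<psi>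
      unfolding eq[OF that that] using that M_D
      by (intro Dplus_mult Dplus_inverse gr.kappa_Dplus lad.ip_Dplus) auto
    moreover have "free_module M"
      using gr.infinite_dim unfolding infinite_dim_free_module_def M_span by blast
    moreover have "linear_operator M (X |` M)" "linear_operator M (P |` M)" "linear_operator M (H |` M)"
      by (intro linear_operator_restrict pl subspace_M pairM.X_S pairM.P_S H_M; assumption)+
    moreover have "H |` M = oscillator_hamiltonian m \<omega> (X |` M) (P |` M)"
      by (simp add: H_eq pairM.hamiltonian_restrict)
    moreover have "self_adjoint ipM (X |` M)" "self_adjoint ipM (P |` M)" "self_adjoint ipM (H |` M)"
      using self_adjoint_restrict[OF sp(2) pairM.X_S eq] self_adjoint_restrict[OF sp(3) pairM.P_S eq]
        self_adjoint_restrict[OF sp(4) H_M eq] by blast+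
    moreover have "scalar_product M ipM"
      unfolding M_span by (rule gr.orthonormalizes_scalar_product[OF ipM])
    moreover have "commutation_relation hbar \<xi> (X |` M) (P |` M)"
      by (rule commutation_relation_restrict[OF comm(2)])
    moreover have "eigenket (H |` M) (\<phi> 0) (of_real ((real 0 + 1/2) * hbar * \<omega>) * \<xi>)"
      using eigen[of 0] \<phi>_M[of 0] by (simp add: eigenket_def)
    moreover have "normalizable ipM (\<phi> 0)"
    proof -
      have "ipM (\<phi> 0) (\<phi> 0) = 1"
        using eq[OF \<phi>_M \<phi>_M, of 0 0] gr.inverse_kappa[of 1] by (simp add: gr.ip_phi_same)
      then show ?thesis
        unfolding normalizable_def by (intro exI[of _ 1]) (simp add: scaleT_one)
    qed
    moreover have "of_real ((real 0 + 1/2) * hbar * \<omega>) * \<xi> \<notin> null_cone"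
      using comm(1) pos by (simp add: null_cone_def)
    moreover have "words_defined_at (lowering_op m \<omega> hbar (X |` M) (P |` M))
        (raising_op m \<omega> hbar (X |` M) (P |` M)) (\<phi> 0)"
      using \<phi>_M[of 0] pairM.ladder_restrict pairM.lower_in pairM.raise_in
      by (intro words_defined_atI[of M]) auto
    moreover have "ipM \<psi> \<chi> = 0"
      if "eigenket (H |` M) \<psi> s" "eigenket (H |` M) \<chi> t" "\<not> null_ket \<psi>" "\<not> null_ket \<chi>" "s - t \<notin> null_cone"
      for \<psi> \<chi> s t
    proof -
      \<comment> \<open>Eigenkets of the restricted Hamiltonian are eigenkets of \<open>H\<close>
        lying in \<open>M\<close>, so assumption (f) for the original product applies and survives
        the factor \<open>inverse \<kappa>\<close>.\<close>
      have "\<psi> \<in> M" "\<chi> \<in> M" "eigenket H \<psi> s" "eigenket H \<chi> t"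
        using that(1,2) by (auto simp: eigenket_def restrict_map_def split: if_splits)
      then show ?thesis
        using orth[of \<psi> s \<chi> t] that eq by simp
    qed
    ultimately show ?thesis
      unfolding bicomplex_oscillator_def using comm(1) not_null by blast
  qed
  have M_dom: "M \<subseteq> dom H" "M \<subseteq> dom A" "M \<subseteq> dom Astar" "M \<subseteq> dom X" "M \<subseteq> dom P"
    using H_M A_apply Astar_apply pairM.X_apply pairM.P_apply M_D by blast+
  have c1: "\<forall>k\<in>{1,2}. proj k Ev \<in> \<real>"
    using Ev_real by blast
  have c2: "\<forall>k\<in>{1,2}. idem k *\<^sub>T E \<in> dom (op_power (Ak k) (level k)) \<and> Ak k (\<phi>0 k) = Some 0"
    using \<phi>0(1) Ak_\<phi>0 by blast
  have c3: "\<forall>k\<in>{1,2}. \<forall>l. \<phi>0 k \<in> dom (op_power (Astark k) l) \<and> \<phi>k k l \<noteq> 0"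
    using u(1) gr.idem_phi_nonzero idem_\<phi> by (metis domI)
  have c4: "\<forall>l. map_option (scaleT (1 / rt l)) (Astar (\<phi> l)) = Some (\<phi> (Suc l))
            \<and> A (\<phi> (Suc l)) = Some (rt l *\<^sub>T \<phi> l)"
    using gr.raise gr.lower by (simp add: A_apply Astar_apply bicomplex_divide)
  have c5: "ip (\<phi> 0) (\<phi> 0) = 1 \<longrightarrow>
          (\<forall>l. ip (\<phi> l) (\<phi> l) = 1)
          \<and> (\<forall>L w v. finite L \<longrightarrow>
               (\<Sum>l\<in>L. dagger (w l) * v l * ip (\<phi> l) (\<phi> l)) = (\<Sum>l\<in>L. dagger (w l) * v l))"
    by (simp add: gr.ip_phi_same)
  have c6: "let defining = (\<lambda>ipM :: 'v \<Rightarrow> 'v \<Rightarrow> bicomplex. \<forall>L w v. finite L \<longrightarrow>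
               ipM (\<Sum>l\<in>L. w l *\<^sub>T \<phi> l) (\<Sum>l\<in>L. v l *\<^sub>T \<phi> l) = (\<Sum>l\<in>L. dagger (w l) * v l))
        in (\<exists>ipM. defining ipM)
           \<and> (\<forall>ipM. defining ipM \<longrightarrow> scalar_product M ipM
                \<and> (\<exists>E' Ev'. bicomplex_oscillator M ipM m \<omega> hbar \<xi> (X |` M) (P |` M) (H |` M) E' Ev'))"
    unfolding Let_def gr.orthonormalizes_def[symmetric]
    using gr.orthonormalizes_exists gr.orthonormalizes_scalar_product[folded M_span] restrict by blast
  show ?thesis
    using c1 c2 c3 eigen gr.ip_phi_diff subspace_M M_dom c4 c5 M_span[symmetric] gr.inj_phi
      gr.independent_phi gr.infinite_dim[folded M_span] c6
    by (intro conjI) blast+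
qed

end
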